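(* Let $Q$ be a countable amenable (discrete) group, let $P$ be a subsemigroup of $Q$ (i.e. $P\subset Q$, $PP\subset P$, $e\in P$), and let $(X,P,T)$ be a directed locally compact semigroup action. Then the semidirect product groupoid $G(X,P,T)$ is topologically amenable.
   Context: A right (partial) action of a semigroup $P$ with identity $e$ on a set $X$ consists of a subset $X*P\subset X\times P$ and a map $X*P\to X$, $(x,m)\mapsto x\cdot m$, such that (i) $(x,e)\in X*P$ and $x\cdot e=x$ for all $x$; (ii) for all $x\in X$, $m,n\in P$: $(x,mn)\in X*P$ iff $(x,m)\in X*P$ and $(x\cdot m,n)\in X*P$, and then $(x\cdot m)\cdot n=x\cdot(mn)$. Put $U(m)=\{x:(x,m)\in X*P\}$, $V(m)=\{x\cdot m:(x,m)\in X*P\}$, $T_m:U(m)\to V(m)$, $T_mx=x\cdot m$. Write $m\le n$ in $P$ if $n=mp$ for some $p\in P$. The action is directed if whenever $U(m)\cap U(n)\neq\emptyset$ there is $r\in P$ with $m\le r$, $n\le r$ and $U(m)\cap U(n)=U(r)$. It is locally compact if $X$ is a locally compact Hausdorff space (second countable, per the paper's standing convention), $Q$ is discrete, and each $U(m),V(m)$ is open with $T_m:U(m)\to V(m)$ a local homeomorphism. The semidirect product groupoid $G(X,P,T)$ is the set of $(x,q,y)\in X\times Q\times X$ such that there are $m,n\in P$ with $q=mn^{-1}$, $x\in U(m)$, $y\in U(n)$, $x\cdot m=y\cdot n$; it is a groupoid with $(x,q,y)(y,q',z)=(x,qq',z)$, $(x,q,y)^{-1}=(y,q^{-1},x)$,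 unit space $X$ (via $x\mapsto(x,e,x)$), and topology with basis the sets $Z(U,m,n,V)=\{(x,mn^{-1},y): x\in U, y\in V, x\cdot m=y\cdot n\}$, $U,V\subset X$ open, $m,n\in P$. *)

theory Defs
  imports "HOL-Analysis.Analysis"
begin

(* The group Q is a type 'q of class group_add; the group law of Q is written
   additively (+, 0, uminus), so  m n^{-1}  of the paper is  m + - n  here.
   group_add does NOT require commutativity. *)

definition amenable_group :: "('q::group_add) itself \<Rightarrow> bool" where
  "amenable_group _ \<longleftrightarrow> (\<exists>\<mu> :: 'q set \<Rightarrow> real.
      \<mu> UNIV = 1 \<and> (\<forall>A. 0 \<le> \<mu> A) \<and>
      (\<forall>A B. A \<inter> B = {} \<longrightarrow> \<mu> (A \<union> B) = \<mu> A + \<mu> B) \<and>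
      (\<forall>g A. \<mu> ((\<lambda>h. g + h) ` A) = \<mu> A))"

definition subsemigroup :: "('q::group_add) set \<Rightarrow> bool" where
  "subsemigroup P \<longleftrightarrow> 0 \<in> P \<and> (\<forall>m\<in>P. \<forall>n\<in>P. m + n \<in> P)"

definition partial_action :: "('q::group_add) set \<Rightarrow> ('x \<times> 'q) set \<Rightarrow> ('x \<Rightarrow> 'q \<Rightarrow> 'x) \<Rightarrow> bool" where
  "partial_action P D act \<longleftrightarrow> D \<subseteq> UNIV \<times> P \<and>
     (\<forall>x. (x, 0) \<in> D \<and> act x 0 = x) \<and>
     (\<forall>x. \<forall>m\<in>P. \<forall>n\<in>P. ((x, m + n) \<in> D \<longleftrightarrow> (x, m) \<in> D \<and> (act x m, n) \<in> D) \<and>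
          ((x, m + n) \<in> D \<longrightarrow> act (act x m) n = act x (m + n)))"

definition Udom :: "('x \<times> 'q) set \<Rightarrow> 'q \<Rightarrow> 'x set" where
  "Udom D m = {x. (x, m) \<in> D}"

definition Vran :: "('x \<times> 'q) set \<Rightarrow> ('x \<Rightarrow> 'q \<Rightarrow> 'x) \<Rightarrow> 'q \<Rightarrow> 'x set" where
  "Vran D act m = {act x m | x. (x, m) \<in> D}"

definition semigroup_le :: "('q::group_add) set \<Rightarrow> 'q \<Rightarrow> 'q \<Rightarrow> bool" where
  "semigroup_le P m n \<longleftrightarrow> (\<exists>p\<in>P. n = m + p)"

definition directed_action :: "('q::group_add) set \<Rightarrow> ('x \<times> 'q) set \<Rightarrow> bool" where
  "directed_action P D \<longleftrightarrow> (\<forall>m\<in>P. \<forall>n\<in>P. Udom D m \<inter> Udom D n \<noteq> {} \<longrightarrow>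
      (\<exists>r\<in>P. semigroup_le P m r \<and> semigroup_le P n r \<and> Udom D m \<inter> Udom D n = Udom D r))"

definition local_homeomorphism :: "('a::topological_space) set \<Rightarrow> ('b::topological_space) set \<Rightarrow> ('a \<Rightarrow> 'b) \<Rightarrow> bool" where
  "local_homeomorphism U V f \<longleftrightarrow> f ` U = V \<and>
     (\<forall>x\<in>U. \<exists>W. open W \<and> x \<in> W \<and> W \<subseteq> U \<and> open (f ` W) \<and>
        (\<exists>g. homeomorphism W (f ` W) f g))"

definition locally_compact_action :: "('q::group_add) set \<Rightarrow> (('x::{t2_space,second_countable_topology}) \<times> 'q) set \<Rightarrow> ('x \<Rightarrow> 'q \<Rightarrow> 'x) \<Rightarrow> bool" where
  "locally_compact_action P D act \<longleftrightarrow> locally compact (UNIV :: 'x set) \<and>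
     (\<forall>m\<in>P. open (Udom D m) \<and> open (Vran D act m) \<and>
        local_homeomorphism (Udom D m) (Vran D act m) (\<lambda>x. act x m))"

definition sdp_groupoid :: "('q::group_add) set \<Rightarrow> ('x \<times> 'q) set \<Rightarrow> ('x \<Rightarrow> 'q \<Rightarrow> 'x) \<Rightarrow> ('x \<times> 'q \<times> 'x) set" where
  "sdp_groupoid P D act = {(x, q, y). \<exists>m\<in>P. \<exists>n\<in>P. q = m + - n \<and> (x, m) \<in> D \<and> (y, n) \<in> D \<and>
        act x m = act y n}"

definition Zset :: "('x \<times> 'q) set \<Rightarrow> ('x \<Rightarrow> 'q \<Rightarrow> 'x) \<Rightarrow> 'x set \<Rightarrow> ('q::group_add) \<Rightarrow> 'q \<Rightarrow> 'x set \<Rightarrow> ('x \<times> 'q \<times> 'x) set" where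
  "Zset D act U m n V = {(x, m + - n, y) | x y. x \<in> U \<and> y \<in> V \<and> (x, m) \<in> D \<and> (y, n) \<in> D \<and>
        act x m = act y n}"

definition sdp_topology :: "('q::group_add) set \<Rightarrow> (('x::topological_space) \<times> 'q) set \<Rightarrow> ('x \<Rightarrow> 'q \<Rightarrow> 'x) \<Rightarrow> ('x \<times> 'q \<times> 'x) topology" where
  "sdp_topology P D act = topology_generated_by
      {Zset D act U m n V | U m n V. open U \<and> open V \<and> m \<in> P \<and> n \<in> P}"

text \<open>Topological amenability (Anantharaman-Delaroche--Renault) of the etale groupoid
G = G(X,P,T) with range r(x,q,y)=x, source s(x,q,y)=y, unit space X.  A system of
probability measures (mu^x) on the (countable, discrete) fibres G^x is given by a
function mu on G with mu^x({h}) = mu h for h in G^x.  It is continuous if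
x |-> integral of f d mu^x is continuous for every f in C_c(G).  G is amenable if
there is a net of continuous systems of probability measures with
sup_{g in K} || g mu^{s(g)} - mu^{r(g)} ||_1 -> 0 for every compact K; equivalently
(taking the net indexed by pairs (K, eps)): for every compact K and eps>0 there is a
continuous system with sup_{g in K} ... < eps.
Here (g mu^{s g})({h}) = mu^{s g}({g^{-1} h}), and for g=(x,q,y), h=(x,q',z):
g^{-1} h = (y, -q + q', z).\<close>
definition sdp_fibre :: "('x \<times> 'q \<times> 'x) set \<Rightarrow> 'x \<Rightarrow> ('x \<times> 'q \<times> 'x) set" where
  "sdp_fibre G x = {h \<in> G. fst h = x}"

definition continuous_prob_system :: "('x::topological_space \<times> ('q::group_add) \<times> 'x) topology \<Rightarrow> ('x \<times> 'q \<times> 'x) set \<Rightarrow> ('x \<times> 'q \<times> 'x \<Rightarrow> real) \<Rightarrow> bool" where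
  "continuous_prob_system TG G \<mu> \<longleftrightarrow>
     (\<forall>h\<in>G. 0 \<le> \<mu> h) \<and>
     (\<forall>x. (\<mu> has_sum 1) (sdp_fibre G x)) \<and>
     (\<forall>f. continuous_map TG euclideanreal f \<and>
          compactin TG (TG closure_of {h \<in> topspace TG. f h \<noteq> 0}) \<longrightarrow>
          continuous_on UNIV (\<lambda>x. \<Sum>\<^sub>\<infinity>h\<in>sdp_fibre G x. \<mu> h * f h))"

definition sdp_topologically_amenable :: "('q::group_add) set \<Rightarrow> (('x::topological_space) \<times> 'q) set \<Rightarrow> ('x \<Rightarrow> 'q \<Rightarrow> 'x) \<Rightarrow> bool" where
  "sdp_topologically_amenable P D act \<longleftrightarrow>
     (let G = sdp_groupoid P D act; TG = sdp_topology P D act in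
      \<forall>K \<epsilon>. compactin TG K \<and> (\<epsilon>::real) > 0 \<longrightarrow>
        (\<exists>\<mu>. continuous_prob_system TG G \<mu> \<and>
           (\<forall>g\<in>K. (\<Sum>\<^sub>\<infinity>h\<in>sdp_fibre G (fst g).
               \<bar>\<mu> h - \<mu> (snd (snd g), - fst (snd g) + fst (snd h), snd (snd h))\<bar>) < \<epsilon>)))"

end

(* The skew product of the groupoid by the cocycle (x, q, y) |-> q has unit space X x Q, on which P acts
   by moving (x, b) to (act x m, b + m). Averaging over Q against an almost invariant finitely
   supported weight reduces the claim to the skew product, restricted to X x A with A finite.
   There all the measures used are combinations of point masses at forward moves of the base point.
   Two devices make this possible. First, an open invariant set admits compactly supported cutoffs that
   are almost invariant along a given compact set of arrows; this holds in every etale groupoid, with no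
   amenability. Secondly, by directedness the saturations of Udom D m x {a}, for a fixed level a and
   varying m, are closed under finite intersection: the intersection over m in J is the saturation
   belonging to one upper bound r(J). Expanding the product of h + (1 - h) over finitely many cutoffs h
   gives weights indexed by the set J of active cutoffs, and the weight of J is pushed forward to
   level a + r(J), where linked points have already merged. *)
theory Submission
  imports Defs "HOL-Analysis.Finite_Function_Topology"
begin

section \<open>Almost invariant weights on an amenable group\<close>

text \<open>Levels turn a comparison of arrows into a comparison of targets: the translate by
  \<open>(x, q, y)\<close> of a move of \<open>y\<close> at level \<open>b + q\<close> coincides
  with a move of \<open>x\<close> at level \<open>b\<close> exactly when both end at the same level
  and the same point. The obstacle is that a saturation only promises that orbits meet eventually: a
  point at level \<open>b\<close> in the saturation for \<open>r\<close> need not have a forward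
  move to level \<open>a + r\<close>, since \<open>- b + (a + r)\<close> may lie outside
  \<open>P\<close>. So each point first gets an anchor, a forward move \<open>u\<close> of its own
  to a level \<open>a + m\<close> with \<open>m\<close> in the active set, and this can be prolonged
  to the upper bound. Anchors are taken beyond the move that witnesses a link, so that the linked
  point can copy them. Different levels \<open>a\<close> have no upper bounds in common, so a second
  subset expansion, over \<open>a\<close> in \<open>A\<close>, selects one reference level per
  active set; an empty active set gets the trivial move. Supports are controlled up to closure
  because a move is defined only on an open set while the weights must be continuous on all of
  \<open>X\<close>.\<close>

definition sublinear :: "('v::real_vector \<Rightarrow> real) \<Rightarrow> bool" where
  "sublinear p \<longleftrightarrow> (\<forall>x y. p (x + y) \<le> p x + p y) \<and> (\<forall>c x. 0 < c \<longrightarrow> p (c *\<^sub>R x) \<le> c * p x)"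

lemma sublinearD:
  assumes "sublinear p"
  shows "p (x + y) \<le> p x + p y" "0 < c \<Longrightarrow> p (c *\<^sub>R x) \<le> c * p x"
  using assms by (auto simp: sublinear_def)

lemma sublinear_zero:
  assumes "sublinear p" shows "p 0 = 0"
  using sublinearD(2)[OF assms, of 2 0] sublinearD(2)[OF assms, of "1/2" 0] by simp

lemma sublinear_neg_le:
  assumes "sublinear p" shows "- p (- x) \<le> p x"
  using sublinearD(1)[OF assms, of x "- x"] sublinear_zero[OF assms] by simp

text \<open>Zorn's lemma with pointwise infima of chains; these are finite because
  \<open>- p (- x) \<le> - q (- x) \<le> q x\<close> for every sublinear
  \<open>q \<le> p\<close>.\<close>

lemma sublinear_minimal:
  fixes p :: "'v::real_vector \<Rightarrow> real"
  assumes p: "sublinear p"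
  obtains q where "sublinear q" "q \<le> p" "\<And>r. sublinear r \<Longrightarrow> r \<le> q \<Longrightarrow> r = q"
proof -
  let ?A = "{q. sublinear q \<and> q \<le> p}"
  \<comment> \<open>The order is reversed, so the maximal element of Zorn's lemma is a minimal
    functional.\<close>
  let ?P = "\<lambda>q r::'v \<Rightarrow> real. r \<le> q"
  have po: "partial_order_on ?A (relation_of ?P ?A)"
    by (rule partial_order_on_relation_ofI) auto
  have "\<exists>m\<in>?A. \<forall>a\<in>?A. ?P m a \<longrightarrow> a = m"
  proof (rule predicate_Zorn[OF po])
    fix C assume C: "C \<in> Chains (relation_of ?P ?A)"
    have CA: "sublinear q" "q \<le> p" if "q \<in> C" for q
      using C that by (auto simp: Chains_def relation_of_def)
    have Cch: "q \<le> r \<or> r \<le> q" if "q \<in> C" "r \<in> C" for q r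
      using C that by (auto simp: Chains_def relation_of_def)
    show "\<exists>u\<in>?A. \<forall>a\<in>C. ?P a u"
    proof (cases "C = {}")
      case True
      then show ?thesis using p by auto
    next
      case False
      define u where "u x = (INF q\<in>C. q x)" for x
      have bd: "bdd_below ((\<lambda>q. q x) ` C)" for x
      proof (rule bdd_belowI2)
        fix q assume q: "q \<in> C"
        have "- p (- x) \<le> - q (- x)" using CA(2)[OF q] by (auto simp: le_fun_def)
        also have "\<dots> \<le> q x" by (rule sublinear_neg_le[OF CA(1)[OF q]])
        finally show "- p (- x) \<le> q x" .
      qed
      have ule: "u x \<le> q x" if "q \<in> C" for q x
        unfolding u_def by (rule cINF_lower[OF bd that])
      have "u (x + y) \<le> u x + u y" for x y
      proof -
        have "u (x + y) - q1 x \<le> q2 y" if q12: "q1 \<in> C" "q2 \<in> C" for q1 q2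
        proof -
          obtain q where q: "q \<in> C" "q \<le> q1" "q \<le> q2" using Cch[OF q12] q12 by (metis order_refl)
          have "u (x + y) \<le> q (x + y)" by (rule ule[OF q(1)])
          also have "\<dots> \<le> q x + q y" by (rule sublinearD(1)[OF CA(1)[OF q(1)]])
          finally show ?thesis using q(2,3) by (auto simp: le_fun_def) (smt (verit))
        qed
        then have "u (x + y) - q1 x \<le> u y" if "q1 \<in> C" for q1
          unfolding u_def[of y] using that by (intro cINF_greatest[OF False]) auto
        then have "u (x + y) - u y \<le> q1 x" if "q1 \<in> C" for q1 
          using that by (smt (verit))
        then have "u (x + y) - u y \<le> u x" 
          unfolding u_def[of x] by (intro cINF_greatest[OF False]) auto
        then show ?thesis by simp
      qed
      moreover have "u (c *\<^sub>R x) \<le> c * u x" if "0 < c" for c x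
      proof -
        have "u (c *\<^sub>R x) / c \<le> u x"
          unfolding u_def[of x]
        proof (rule cINF_greatest[OF False])
          fix q assume q: "q \<in> C"
          have "u (c *\<^sub>R x) \<le> q (c *\<^sub>R x)" by (rule ule[OF q])
          also have "\<dots> \<le> c * q x" by (rule sublinearD(2)[OF CA(1)[OF q] that])
          finally show "u (c *\<^sub>R x) / c \<le> q x" using that by (simp add: field_simps)
        qed
        then show ?thesis using that by (simp add: field_simps)
      qed
      ultimately have "sublinear u" by (auto simp: sublinear_def)
      moreover have "u \<le> p" 
        using False CA(2) ule by (fastforce simp: le_fun_def intro: order_trans)
      ultimately show ?thesis using ule by (auto simp: le_fun_def intro!: bexI[of _ u])
    qed
  qed
  then obtain q where q: "sublinear q" "q \<le> p" "\<forall>a. sublinear a \<and> a \<le> p \<longrightarrow> a \<le> q \<longrightarrow> a = q"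
    by blast
  show thesis
  proof (rule that[OF q(1,2)])
    fix r assume "sublinear r" "r \<le> q"
    then show "r = q" using q by (meson order_trans)
  qed
qed

text \<open>Hahn-Banach in its algebraic form: a minimal sublinear functional is already linear,
  because any failure of \<open>q (- y) = - q y\<close> would allow it to be lowered.\<close>

lemma linear_below_sublinear:
  fixes p :: "'v::real_vector \<Rightarrow> real"
  assumes p: "sublinear p"
  obtains L where "linear L" "\<And>x. L x \<le> p x"
proof -
  obtain q where q: "sublinear q" "q \<le> p" and min: "\<And>r. sublinear r \<Longrightarrow> r \<le> q \<Longrightarrow> r = q"
    by (rule sublinear_minimal[OF p]) blast
  note q1 = sublinearD(1)[OF q(1)] and q2 = sublinearD(2)[OF q(1)]
  have neg: "q (- y) = - q y" for y
  proof -
    \<comment> \<open>This lowers \<open>q\<close> along \<open>y\<close>: \<open>t = 0\<close>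
      gives \<open>r \<le> q\<close>, so \<open>r = q\<close> by minimality, and then
      \<open>t = 1\<close> at \<open>- y\<close> gives \<open>q (- y) \<le> - q y\<close>.\<close>
    define r where "r x = (INF t\<in>{0..}. q (x + t *\<^sub>R y) - t * q y)" for x
    have scale: "t * q y \<le> q (t *\<^sub>R y)" "q (t *\<^sub>R y) \<le> t * q y" if "0 \<le> t" for t
      using q2[of "1 / t" "t *\<^sub>R y"] q2[of t y] that sublinear_zero[OF q(1)]
      by (cases "t = 0"; simp add: field_simps)+
    have bd: "bdd_below ((\<lambda>t. q (x + t *\<^sub>R y) - t * q y) ` {0..})" for x
    proof (rule bdd_belowI2)
      fix t :: real assume "t \<in> {0..}"
      then have "t * q y \<le> q (t *\<^sub>R y)" using scale by simp
      also have "\<dots> \<le> q (x + t *\<^sub>R y) + q (- x)" using q1[of "x + t *\<^sub>R y" "- x"] by simp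
      finally show "- q (- x) \<le> q (x + t *\<^sub>R y) - t * q y" by simp
    qed
    have rle: "r x \<le> q (x + t *\<^sub>R y) - t * q y" if "0 \<le> t" for t x
      unfolding r_def by (rule cINF_lower[OF bd]) (use that in simp)
    have "r (x + x') \<le> r x + r x'" for x x'
    proof -
      have *: "r (x + x') - (q (x + s *\<^sub>R y) - s * q y) \<le> q (x' + t *\<^sub>R y) - t * q y" 
        if "0 \<le> s" "0 \<le> t" for s t
      proof -
        have "r (x + x') \<le> q ((x + s *\<^sub>R y) + (x' + t *\<^sub>R y)) - (s + t) * q y"
          using rle[of "s + t" "x + x'"] that by (simp add: algebra_simps)
        with q1[of "x + s *\<^sub>R y" "x' + t *\<^sub>R y"] show ?thesis by (simp add: algebra_simps)
      qed
      have "r (x + x') - (q (x + s *\<^sub>R y) - s * q y) \<le> r x'" if "0 \<le> s" for s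
        unfolding r_def[of x'] using *[OF that] by (intro cINF_greatest) auto
      then have "r (x + x') - r x' \<le> q (x + s *\<^sub>R y) - s * q y" if "0 \<le> s" for s 
        using that by (smt (verit))
      then have "r (x + x') - r x' \<le> r x"
        unfolding r_def[of x] by (intro cINF_greatest) auto
      then show ?thesis by simp
    qed
    moreover have "r (c *\<^sub>R x) \<le> c * r x" if c: "0 < c" for c x
    proof -
      have "r (c *\<^sub>R x) / c \<le> r x"
        unfolding r_def[of x]
      proof (rule cINF_greatest)
        fix t :: real assume t: "t \<in> {0..}"
        have "r (c *\<^sub>R x) \<le> q (c *\<^sub>R x + (c * t) *\<^sub>R y) - (c * t) * q y"
          using t c by (intro rle) simp
        also have "c *\<^sub>R x + (c * t) *\<^sub>R y = c *\<^sub>R (x + t *\<^sub>R y)" by (simp add: algebra_simps)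
        also have "q \<dots> - (c * t) * q y \<le> c * (q (x + t *\<^sub>R y) - t * q y)"
          using q2[OF c, of "x + t *\<^sub>R y"] by (simp add: algebra_simps)
        finally show "r (c *\<^sub>R x) / c \<le> q (x + t *\<^sub>R y) - t * q y" 
          using c by (simp add: field_simps)
      qed simp
      then show ?thesis using c by (simp add: field_simps)
    qed
    ultimately have "sublinear r" by (auto simp: sublinear_def)
    moreover have "r \<le> q" using rle[of 0] by (simp add: le_fun_def)
    ultimately have "r = q" by (rule min)
    then have "q (- y) \<le> - q y" using rle[of 1 "- y"] sublinear_zero[OF q(1)] by simp
    then show ?thesis using sublinear_neg_le[OF q(1), of "- y"] by simp
  qed
  have add: "q (x + y) = q x + q y" for x y
    using q1[of x y] q1[of "- x" "- y"] neg[of x] neg[of y] neg[of "x + y"] by simp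
  have pos: "q (c *\<^sub>R x) = c * q x" if "0 < c" for c x
    using q2[OF that, of x] q2[of "1/c" "c *\<^sub>R x"] that by (simp add: field_simps)
  have scale: "q (c *\<^sub>R x) = c * q x" for c x
  proof (cases c "0::real" rule: linorder_cases)
    case less
    then show ?thesis using pos[of "- c" "x"] neg[of "c *\<^sub>R x"] by simp
  qed (use pos sublinear_zero[OF q(1)] in auto)
  show thesis
    by (rule that[of q]) (use q(2) add scale in \<open>auto intro!: linearI simp: le_fun_def\<close>)
qed

lemma convex_norm_separation:
  fixes W :: "'v::real_normed_vector set"
  assumes W: "convex W" "W \<noteq> {}" and far: "\<And>x. x \<in> W \<Longrightarrow> \<epsilon> \<le> norm x"
  obtains L where "linear L" "\<And>w. \<bar>L w\<bar> \<le> norm w" "\<And>x. x \<in> W \<Longrightarrow> \<epsilon> \<le> L x"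
proof -
  let ?I = "{0::real..} \<times> W" 
  let ?g = "\<lambda>w (s, x). norm (w + s *\<^sub>R x) - s * \<epsilon>"
  \<comment> \<open>Domination by \<open>p\<close> encodes both wanted bounds: \<open>s = 0\<close>
    gives \<open>L w \<le> norm w\<close>, and \<open>s = 1\<close> at \<open>w = - x\<close> gives
    \<open>L (- x) \<le> - \<epsilon>\<close>.\<close>
  define p where "p w = (INF sx\<in>?I. ?g w sx)" for w
  obtain x0 where x0: "x0 \<in> W" using W(2) by auto
  then have "(0, x0) \<in> ?I" by simp
  then have ne: "?I \<noteq> {}" by blast
  have bd: "bdd_below (?g w ` ?I)" for w
  proof (rule bdd_belowI2)
    fix sx assume "sx \<in> ?I"
    then obtain s x where sx: "sx = (s, x)" "0 \<le> s" "x \<in> W" by auto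
    have "s * \<epsilon> \<le> norm (s *\<^sub>R x)" using far[OF sx(3)] sx(2) by (simp add: mult_left_mono)
    also have "\<dots> \<le> norm (w + s *\<^sub>R x) + norm w" 
      by (metis add_diff_cancel_left' norm_triangle_ineq4)
    finally show "- norm w \<le> ?g w sx" using sx(1) by simp
  qed
  have ple: "p w \<le> norm (w + s *\<^sub>R x) - s * \<epsilon>" if "0 \<le> s" "x \<in> W" for w s x
    unfolding p_def using cINF_lower[OF bd, of "(s, x)" w] that by simp
  have pge: "z \<le> p w" if "\<And>s x. 0 \<le> s \<Longrightarrow> x \<in> W \<Longrightarrow> z \<le> norm (w + s *\<^sub>R x) - s * \<epsilon>" for z w
    unfolding p_def by (intro cINF_greatest[OF ne]) (use that in auto)
  have "p (w + w') \<le> p w + p w'" for w w'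
  proof -
    have *: "p (w + w') \<le> (norm (w + s *\<^sub>R x) - s * \<epsilon>) + (norm (w' + t *\<^sub>R y) - t * \<epsilon>)"
      if st: "0 \<le> s" "x \<in> W" "0 \<le> t" "y \<in> W" for s t x y
    proof -
      \<comment> \<open>Convexity of \<open>W\<close> enters here: the two multiples merge into one,
        which is what subadditivity of \<open>p\<close> needs.\<close>
      obtain z where z: "z \<in> W" "(s + t) *\<^sub>R z = s *\<^sub>R x + t *\<^sub>R y"
      proof (cases "s + t = 0")
        case True
        then have "s = 0" "t = 0" using st by auto
        then show ?thesis using that[of x] st by simp
      next
        case False
        show ?thesis
        proof (rule that)
          show "(s / (s + t)) *\<^sub>R x + (t / (s + t)) *\<^sub>R y \<in> W"
            using False st by (intro convexD[OF W(1)]) (auto simp: add_divide_distrib[symmetric])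
          show "(s + t) *\<^sub>R ((s / (s + t)) *\<^sub>R x + (t / (s + t)) *\<^sub>R y) = s *\<^sub>R x + t *\<^sub>R y"
            using False by (simp add: scaleR_right_distrib)
        qed
      qed
      have "p (w + w') \<le> norm (w + w' + (s + t) *\<^sub>R z) - (s + t) * \<epsilon>"
        using st z(1) by (intro ple) auto
      also have "w + w' + (s + t) *\<^sub>R z = (w + s *\<^sub>R x) + (w' + t *\<^sub>R y)" using z(2) by simp
      also have "norm \<dots> \<le> norm (w + s *\<^sub>R x) + norm (w' + t *\<^sub>R y)" by (rule norm_triangle_ineq)
      finally show ?thesis by (simp add: algebra_simps)
    qed
    have "p (w + w') - (norm (w + s *\<^sub>R x) - s * \<epsilon>) \<le> p w'" if "0 \<le> s" "x \<in> W" for s x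
      by (rule pge) (use *[OF that] in \<open>smt (verit)\<close>)
    then have "p (w + w') - p w' \<le> p w"
      by (intro pge) (smt (verit))
    then show ?thesis by simp
  qed
  moreover have "p (c *\<^sub>R w) \<le> c * p w" if c: "0 < c" for c w
  proof -
    have "p (c *\<^sub>R w) / c \<le> p w"
    proof (rule pge)
      fix s x assume sx: "0 \<le> (s::real)" "x \<in> W"
      have "p (c *\<^sub>R w) \<le> norm (c *\<^sub>R w + (c * s) *\<^sub>R x) - (c * s) * \<epsilon>"
        using sx c by (intro ple) auto
      also have "c *\<^sub>R w + (c * s) *\<^sub>R x = c *\<^sub>R (w + s *\<^sub>R x)" by (simp add: algebra_simps)
      also have "norm \<dots> - (c * s) * \<epsilon> = c * (norm (w + s *\<^sub>R x) - s * \<epsilon>)"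
        using c by (simp add: right_diff_distrib)
      finally show "p (c *\<^sub>R w) / c \<le> norm (w + s *\<^sub>R x) - s * \<epsilon>"
        using c by (simp add: field_simps)
    qed
    then show ?thesis using c by (simp add: field_simps)
  qed
  ultimately have "sublinear p" by (auto simp: sublinear_def)
  then obtain L where L: "linear L" "\<And>x. L x \<le> p x" by (rule linear_below_sublinear) blast
  have Ln: "L w \<le> norm w" for w using L(2)[of w] ple[of 0 x0 w] x0 by simp
  show thesis
  proof (rule that[OF L(1)])
    show "\<bar>L w\<bar> \<le> norm w" for w
      using Ln[of w] Ln[of "- w"] linear_neg[OF L(1), of w] by simp
    show "\<epsilon> \<le> L x" if "x \<in> W" for x
      using L(2)[of "- x"] ple[of 1 x "- x"] that linear_neg[OF L(1), of x] by simp
  qed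
qed

section \<open>From an invariant mean to Reiter weights\<close>

text \<open>Replaces integration of a pointwise inequality between sums of indicators. The finitely
  many sets generate a finite partition, indexed by the membership pattern \<open>\<psi> t\<close>,
  and on each of its atoms both counts are constant.\<close>

lemma finitely_additive_sum_mono:
  fixes \<mu> :: "'q set \<Rightarrow> real"
  assumes pos: "\<And>A. 0 \<le> \<mu> A" and add: "\<And>A B. A \<inter> B = {} \<Longrightarrow> \<mu> (A \<union> B) = \<mu> A + \<mu> B"
    and I: "finite I" 
    and le: "\<And>t. Suc (card {i\<in>I. t \<in> B i}) \<le> card {i\<in>I. t \<in> A i}"
  shows "\<mu> UNIV + (\<Sum>i\<in>I. \<mu> (B i)) \<le> (\<Sum>i\<in>I. \<mu> (A i))"
proof -
  have empty: "\<mu> {} = 0" using add[of "{}" "{}"] by simp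
  define \<psi> where "\<psi> t = ({i\<in>I. t \<in> A i}, {i\<in>I. t \<in> B i})" for t
  let ?\<Pi> = "Pow I \<times> Pow I"
  let ?F = "\<lambda>\<pi>. {t. \<psi> t = \<pi>}"
  have fin: "finite ?\<Pi>" using I by simp
  have Un: "\<mu> (S \<inter> {t. \<psi> t \<in> R}) = (\<Sum>\<pi>\<in>R. \<mu> (S \<inter> ?F \<pi>))" if "finite R" for S R
    using that
  proof (induction R)
    case (insert \<pi> R)
    have "S \<inter> {t. \<psi> t \<in> insert \<pi> R} = (S \<inter> ?F \<pi>) \<union> (S \<inter> {t. \<psi> t \<in> R})" by auto
    moreover have "\<mu> \<dots> = \<mu> (S \<inter> ?F \<pi>) + \<mu> (S \<inter> {t. \<psi> t \<in> R})" 
      by (rule add) (use insert in auto)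
    ultimately show ?case using insert by simp
  qed (simp add: empty)
  have split: "\<mu> S = (\<Sum>\<pi>\<in>?\<Pi>. \<mu> (S \<inter> ?F \<pi>))" for S
  proof -
    have "S \<inter> {t. \<psi> t \<in> ?\<Pi>} = S" by (auto simp: \<psi>_def)
    then show ?thesis using Un[OF fin, of S] by simp
  qed
  have count: "(\<Sum>i\<in>I. \<mu> (C i)) = (\<Sum>\<pi>\<in>?\<Pi>. card (h \<pi>) * \<mu> (?F \<pi>))" 
    if C: "\<And>\<pi> i. \<pi> \<in> ?\<Pi> \<Longrightarrow> i \<in> I \<Longrightarrow> C i \<inter> ?F \<pi> = (if i \<in> h \<pi> then ?F \<pi> else {})"
      and h: "\<And>\<pi>. \<pi> \<in> ?\<Pi> \<Longrightarrow> h \<pi> \<subseteq> I" for C h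
  proof -
    have "(\<Sum>i\<in>I. \<mu> (C i)) = (\<Sum>i\<in>I. \<Sum>\<pi>\<in>?\<Pi>. \<mu> (C i \<inter> ?F \<pi>))"
      by (rule sum.cong[OF refl]) (rule split)
    also have "\<dots> = (\<Sum>\<pi>\<in>?\<Pi>. \<Sum>i\<in>I. \<mu> (C i \<inter> ?F \<pi>))" by (rule sum.swap)
    also have "\<dots> = (\<Sum>\<pi>\<in>?\<Pi>. card (h \<pi>) * \<mu> (?F \<pi>))"
    proof (rule sum.cong[OF refl])
      fix \<pi> assume \<pi>: "\<pi> \<in> ?\<Pi>"
      have "(\<Sum>i\<in>I. \<mu> (C i \<inter> ?F \<pi>)) = (\<Sum>i\<in>I. if i \<in> h \<pi> then \<mu> (?F \<pi>) else 0)"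
        using C[OF \<pi>] empty by (intro sum.cong) auto
      also have "\<dots> = (\<Sum>i\<in>I \<inter> h \<pi>. \<mu> (?F \<pi>))" using I by (rule sum.inter_restrict[symmetric])
      also have "I \<inter> h \<pi> = h \<pi>" using h[OF \<pi>] by auto
      finally show "(\<Sum>i\<in>I. \<mu> (C i \<inter> ?F \<pi>)) = card (h \<pi>) * \<mu> (?F \<pi>)" by simp
    qed
    finally show ?thesis .
  qed
  have "(\<Sum>i\<in>I. \<mu> (A i)) - (\<Sum>i\<in>I. \<mu> (B i)) 
      = (\<Sum>\<pi>\<in>?\<Pi>. card (fst \<pi>) * \<mu> (?F \<pi>)) - (\<Sum>\<pi>\<in>?\<Pi>. card (snd \<pi>) * \<mu> (?F \<pi>))"
    by (intro arg_cong2[where f = "(-)"] count) (auto simp: \<psi>_def)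
  also have "\<dots> = (\<Sum>\<pi>\<in>?\<Pi>. (real (card (fst \<pi>)) - card (snd \<pi>)) * \<mu> (?F \<pi>))"
    by (simp add: sum_subtractf left_diff_distrib)
  also have "\<dots> \<ge> (\<Sum>\<pi>\<in>?\<Pi>. \<mu> (?F \<pi>))"
  proof (rule sum_mono)
    fix \<pi> assume "\<pi> \<in> ?\<Pi>"
    show "\<mu> (?F \<pi>) \<le> (real (card (fst \<pi>)) - card (snd \<pi>)) * \<mu> (?F \<pi>)"
    proof (cases "?F \<pi> = {}")
      case False
      then obtain t where "\<psi> t = \<pi>" by auto
      then have "1 \<le> real (card (fst \<pi>)) - card (snd \<pi>)" using le[of t] by (auto simp: \<psi>_def)
      from mult_right_mono[OF this pos] show ?thesis by simp
    next
      case True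
      then show ?thesis using empty by (simp only:)
    qed
  qed
  finally show ?thesis using split[of UNIV] by simp
qed

text \<open>A function and its translate have the same mean, so the sum has mean zero and cannot
  stay above \<open>\<epsilon>\<close>. Since \<open>\<mu>\<close> measures only sets, the functions
  are rounded to integers and cut into level sets.\<close>

lemma amenable_no_gap:
  fixes u :: "'q::group_add \<Rightarrow> 'q \<Rightarrow> real"
  assumes am: "amenable_group TYPE('q)" and F: "finite F" and u: "\<And>g t. \<bar>u g t\<bar> \<le> 1"
    and \<epsilon>: "0 < \<epsilon>"
  shows "\<exists>t. (\<Sum>g\<in>F. u g t - u g (g + t)) < \<epsilon>"
proof (rule ccontr)
  assume "\<not> ?thesis"
  then have gap: "\<epsilon> \<le> (\<Sum>g\<in>F. u g t - u g (g + t))" for t by (simp add: not_less)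
  obtain \<mu> :: "'q set \<Rightarrow> real" where \<mu>: "\<mu> UNIV = 1" "\<And>A. 0 \<le> \<mu> A"
      "\<And>A B. A \<inter> B = {} \<Longrightarrow> \<mu> (A \<union> B) = \<mu> A + \<mu> B" "\<And>g A. \<mu> ((+) g ` A) = \<mu> A"
    using am by (auto simp: amenable_group_def)
  \<comment> \<open>Rounding costs less than 1 for each \<open>g\<close>, hence at most
    \<open>card F\<close> in total; with \<open>N * \<epsilon>\<close> above that, the integer
    counts still differ by at least 1.\<close>
  obtain N :: nat where N: "card F / \<epsilon> < N" using reals_Archimedean2 by blast
  have N\<epsilon>: "card F < N * \<epsilon>" using N \<epsilon> by (simp add: field_simps)
  define k where "k g t = nat \<lfloor>N * (u g t + 1)\<rfloor>" for g t
  have nn: "0 \<le> real N * (u g t + 1)" "real N * (u g t + 1) \<le> 2 * N" for g t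
    using u[of g t] mult_left_mono[of "u g t + 1" 2 "real N"] by (auto simp: abs_le_iff)
  have k: "real (k g t) \<le> N * (u g t + 1)" "N * (u g t + 1) < real (k g t) + 1" for g t
    using nn[of g t] unfolding k_def by linarith+
  have k2: "k g t \<le> 2 * N" for g t using k(1)[of g t] nn(2)[of g t] by linarith
  let ?I = "F \<times> {1..2 * N}"
  \<comment> \<open>Level sets: \<open>k g t\<close> is the number of \<open>j\<close> in
    \<open>{1..2 * N}\<close> with \<open>j \<le> k g t\<close>, so sums of \<open>k\<close> become
    counts of memberships. Translation by \<open>g\<close> carries \<open>?B (g, j)\<close> onto
    \<open>?A (g, j)\<close>.\<close>
  let ?A = "\<lambda>(g, j). {t. j \<le> k g t}" and ?B = "\<lambda>(g, j). {t. j \<le> k g (g + t)}"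
  have cnt: "card {i\<in>?I. case i of (g, j) \<Rightarrow> j \<le> k g (s g)} = (\<Sum>g\<in>F. k g (s g))" for s
  proof -
    have "{i\<in>?I. case i of (g, j) \<Rightarrow> j \<le> k g (s g)} = (SIGMA g:F. {1..k g (s g)})"
      by (auto intro: le_trans[OF _ k2])
    then show ?thesis using F by simp
  qed
  have "\<mu> UNIV + (\<Sum>i\<in>?I. \<mu> (?B i)) \<le> (\<Sum>i\<in>?I. \<mu> (?A i))"
  proof (rule finitely_additive_sum_mono[OF \<mu>(2,3)])
    fix t
    have "0 < N * (\<Sum>g\<in>F. u g t - u g (g + t)) - card F"
      using mult_left_mono[OF gap[of t], of N] N\<epsilon> by simp
    also have "\<dots> = (\<Sum>g\<in>F. N * (u g t + 1) - N * (u g (g + t) + 1) - 1)"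
      by (simp add: sum_subtractf sum_distrib_left sum.distrib algebra_simps)
    also have "\<dots> \<le> (\<Sum>g\<in>F. real (k g t) - real (k g (g + t)))"
    proof (rule sum_mono)
      fix g
      show "N * (u g t + 1) - N * (u g (g + t) + 1) - 1 \<le> real (k g t) - real (k g (g + t))"
        using k(2)[of g t] k(1)[of g "g + t"] by linarith
    qed
    finally have "real (\<Sum>g\<in>F. k g (g + t)) < real (\<Sum>g\<in>F. k g t)" by (simp add: sum_subtractf)
    then have "(\<Sum>g\<in>F. k g (g + t)) < (\<Sum>g\<in>F. k g t)" by (simp only: of_nat_less_iff)
    then have "Suc (\<Sum>g\<in>F. k g (g + t)) \<le> (\<Sum>g\<in>F. k g t)" by simp
    then show "Suc (card {i\<in>?I. t \<in> ?B i}) \<le> card {i\<in>?I. t \<in> ?A i}"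
      using cnt[of "\<lambda>g. g + t"] cnt[of "\<lambda>g. t"] by (simp add: case_prod_unfold)
  qed (use F in auto)
  moreover have "\<mu> (?B i) = \<mu> (?A i)" for i
  proof -
    have "(+) (fst i) ` ?B i = ?A i"
    proof (intro set_eqI iffI)
      fix t assume "t \<in> ?A i"
      then have "- fst i + t \<in> ?B i" by (auto simp: case_prod_unfold add.assoc[symmetric])
      then show "t \<in> (+) (fst i) ` ?B i" by (intro image_eqI[of _ _ "- fst i + t"]) (auto simp: add.assoc[symmetric])
    qed (auto simp: case_prod_unfold)
    then show ?thesis using \<mu>(4)[of "fst i" "?B i"] by simp
  qed
  ultimately show False using \<mu>(1) by simp
qed

lemma norm_poly_mapping_eq_sum:
  "norm x = (\<Sum>i\<in>Poly_Mapping.keys x. norm (Poly_Mapping.lookup x i))"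
  by (simp add: norm_poly_mapping_def dist_poly_mapping_def)

lemma sum_lookup_le_norm:
  fixes x :: "'a \<Rightarrow>\<^sub>0 real"
  assumes "finite B"
  shows "(\<Sum>i\<in>B. \<bar>Poly_Mapping.lookup x i\<bar>) \<le> norm x"
proof -
  have "(\<Sum>i\<in>B. \<bar>Poly_Mapping.lookup x i\<bar>) \<le> (\<Sum>i\<in>B \<union> Poly_Mapping.keys x. \<bar>Poly_Mapping.lookup x i\<bar>)"
    using assms by (intro sum_mono2) auto
  also have "\<dots> = norm x"
    unfolding norm_poly_mapping_eq_sum using assms
    by (intro sum.mono_neutral_cong_right) (auto simp: in_keys_iff)
  finally show ?thesis .
qed

lemma lookup_scaleR: "Poly_Mapping.lookup (c *\<^sub>R x) i = c *\<^sub>R Poly_Mapping.lookup x i"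
proof -
  have "finite {i. c *\<^sub>R Poly_Mapping.lookup x i \<noteq> 0}"
    by (rule finite_subset[of _ "Poly_Mapping.keys x"]) (auto simp: in_keys_iff)
  then show ?thesis by (simp add: scaleR_poly_mapping_def Abs_poly_mapping_inverse)
qed

text \<open>The convexity argument of Day and Namioka. If the convex hull of the vectors
  \<open>v t\<close> kept distance \<open>\<epsilon>\<close> from 0, a separating functional
  evaluated at point masses would be a bounded function contradicting
  \<open>amenable_no_gap\<close>. The first coordinate of the keys keeps the different
  \<open>g\<close> apart, so that one convex combination serves all of them.\<close>

lemma reiter_left:
  fixes F :: "'q::group_add set"
  assumes am: "amenable_group TYPE('q)" and F: "finite F" and \<epsilon>: "0 < \<epsilon>"
  obtains f :: "'q \<Rightarrow> real" and A where "finite A" "\<And>b. 0 \<le> f b" "\<And>b. b \<notin> A \<Longrightarrow> f b = 0" "sum f A = 1"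
    "\<And>g B. g \<in> F \<Longrightarrow> finite B \<Longrightarrow> (\<Sum>b\<in>B. \<bar>f b - f (- g + b)\<bar>) < \<epsilon>"
proof -
  define v :: "'q \<Rightarrow> ('q \<times> 'q) \<Rightarrow>\<^sub>0 real" 
    where "v t = (\<Sum>g\<in>F. Poly_Mapping.single (g, t) 1 - Poly_Mapping.single (g, g + t) 1)" for t
  have "\<exists>x\<in>convex hull (range v). norm x < \<epsilon>"
  proof (rule ccontr)
    assume "\<not> ?thesis"
    then have far: "\<epsilon> \<le> norm x" if "x \<in> convex hull (range v)" for x using that by force
    obtain L where L: "linear L" "\<And>w. \<bar>L w\<bar> \<le> norm w" "\<And>x. x \<in> convex hull (range v) \<Longrightarrow> \<epsilon> \<le> L x"
      by (rule convex_norm_separation[OF convex_convex_hull _ far]) auto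
    have "\<exists>t. (\<Sum>g\<in>F. L (Poly_Mapping.single (g, t) 1) - L (Poly_Mapping.single (g, g + t) 1)) < \<epsilon>"
      by (rule amenable_no_gap[OF am F _ \<epsilon>, of "\<lambda>g t. L (Poly_Mapping.single (g, t) 1)"])
        (use L(2) in \<open>auto intro!: order_trans[OF L(2)] simp: norm_poly_mapping_eq_sum\<close>)
    then obtain t where "L (v t) < \<epsilon>" 
      unfolding v_def linear_sum[OF L(1)] linear_diff[OF L(1)] by auto
    moreover have "\<epsilon> \<le> L (v t)" by (rule L(3)) (simp add: hull_inc)
    ultimately show False by simp
  qed
  then obtain x where x: "x \<in> convex hull (range v)" "norm x < \<epsilon>" by auto
  then obtain S c where S: "finite S" "S \<subseteq> range v" "\<And>y. y \<in> S \<Longrightarrow> 0 \<le> c y" "sum c S = 1" "(\<Sum>y\<in>S. c y *\<^sub>R y) = x"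
    by (auto simp: convex_hull_explicit)
  \<comment> \<open>\<open>v\<close> need not be injective, so one group element is chosen for each
    vector in the convex combination and receives its whole coefficient.\<close>
  define \<tau> where "\<tau> = inv v"
  have \<tau>: "v (\<tau> y) = y" if "y \<in> S" for y using that S(2) by (auto simp: \<tau>_def f_inv_into_f)
  have inj: "inj_on \<tau> S" using \<tau> by (metis inj_onI)
  define f where "f t = (if t \<in> \<tau> ` S then c (v t) else 0)" for t
  have "sum f (\<tau> ` S) = (\<Sum>y\<in>S. c y)"
    unfolding sum.reindex[OF inj] by (intro sum.cong) (auto simp: f_def \<tau>)
  then have f1: "sum f (\<tau> ` S) = 1" using S(4) by simp
  have xf: "x = (\<Sum>t\<in>\<tau> ` S. f t *\<^sub>R v t)"
    unfolding sum.reindex[OF inj] S(5)[symmetric] by (intro sum.cong) (auto simp: f_def \<tau>)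
  have look: "Poly_Mapping.lookup x (g, b) = f b - f (- g + b)" if g: "g \<in> F" for g b
  proof -
    have lv: "Poly_Mapping.lookup (v t) (g, b) = of_bool (t = b) - of_bool (t = - g + b)" for t
    proof -
      have eq: "(g + t = b) = (t = - g + b)" by (metis add.assoc add.left_inverse add.right_inverse add_0)
      have "Poly_Mapping.lookup (v t) (g, b) 
          = (\<Sum>h\<in>F. if h = g then of_bool (t = b) - of_bool (t = - g + b) else (0::real))"
        unfolding v_def lookup_sum lookup_minus lookup_single
        by (rule sum.cong) (auto simp: when_def eq)
      then show ?thesis using F g by simp
    qed
    have "Poly_Mapping.lookup x (g, b) = (\<Sum>t\<in>\<tau> ` S. f t * (of_bool (t = b) - of_bool (t = - g + b)))"
      unfolding xf lookup_sum lookup_scaleR lv by simp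
    also have "\<dots> = (\<Sum>t\<in>\<tau> ` S. if t = b then f t else 0) - (\<Sum>t\<in>\<tau> ` S. if t = - g + b then f t else 0)"
      unfolding sum_subtractf[symmetric] by (intro sum.cong) auto
    also have "\<dots> = f b - f (- g + b)" using S(1) by (auto simp: f_def)
    finally show ?thesis .
  qed
  show thesis
  proof (rule that[OF _ _ _ f1])
    fix g B assume g: "g \<in> F" and B: "finite (B :: 'q set)"
    have "(\<Sum>b\<in>B. \<bar>f b - f (- g + b)\<bar>) = (\<Sum>i\<in>Pair g ` B. \<bar>Poly_Mapping.lookup x i\<bar>)"
      by (subst sum.reindex) (auto simp: inj_on_def look[OF g])
    also have "\<dots> \<le> norm x" using B by (intro sum_lookup_le_norm) simp
    finally show "(\<Sum>b\<in>B. \<bar>f b - f (- g + b)\<bar>) < \<epsilon>" using x(2) by simp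
  qed (use S \<tau> in \<open>auto simp: f_def\<close>)
qed

text \<open>Inversion exchanges left and right translation. The right-handed form is wanted because
  an arrow with cocycle value \<open>q\<close> leads from level \<open>b\<close> to level
  \<open>b + q\<close>.\<close>

lemma reiter_right:
  fixes F :: "'q::group_add set"
  assumes am: "amenable_group TYPE('q)" and F: "finite F" and \<epsilon>: "0 < \<epsilon>"
  obtains f :: "'q \<Rightarrow> real" and A where "finite A" "\<And>b. 0 \<le> f b" "\<And>b. b \<notin> A \<Longrightarrow> f b = 0" "sum f A = 1"
    "\<And>g B. g \<in> F \<Longrightarrow> finite B \<Longrightarrow> (\<Sum>b\<in>B. \<bar>f b - f (b + g)\<bar>) < \<epsilon>"
proof -
  obtain f :: "'q \<Rightarrow> real" and A where f: "finite A" "\<And>b. 0 \<le> f b" "\<And>b. b \<notin> A \<Longrightarrow> f b = 0" "sum f A = 1"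
    "\<And>g B. g \<in> F \<Longrightarrow> finite B \<Longrightarrow> (\<Sum>b\<in>B. \<bar>f b - f (- g + b)\<bar>) < \<epsilon>"
    by (rule reiter_left[OF am F \<epsilon>]) blast
  have inj: "inj_on uminus B" for B :: "'q set" by (simp add: inj_on_def)
  have 0: "f (- b) = 0" if "b \<notin> uminus ` A" for b
    using f(3)[of "- b"] that by (metis image_eqI minus_minus)
  show thesis
  proof (rule that[of "uminus ` A" "\<lambda>b. f (- b)"])
    show "(\<Sum>b\<in>uminus ` A. f (- b)) = 1" by (subst sum.reindex[OF inj]) (simp add: f(4))
    fix g B assume "g \<in> F" "finite (B :: 'q set)"
    then have "(\<Sum>b\<in>uminus ` B. \<bar>f b - f (- g + b)\<bar>) < \<epsilon>" by (intro f(5)) auto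
    then show "(\<Sum>b\<in>B. \<bar>f (- b) - f (- (b + g))\<bar>) < \<epsilon>" 
      by (subst (asm) sum.reindex[OF inj]) (simp add: minus_add)
  qed (use f(1,2) 0 in auto)
qed

section \<open>Cutoffs and subset expansions\<close>

lemma locally_compact_neighbourhood:
  assumes lc: "locally compact (UNIV :: 'x::t2_space set)" and W: "open W" "(x::'x) \<in> W"
  obtains K where "compact K" "x \<in> interior K" "K \<subseteq> W"
proof -
  obtain u v where uv: "open u" "compact v" "x \<in> u" "u \<subseteq> v" "v \<subseteq> W"
    using lc W unfolding locally_def by (metis open_openin subtopology_UNIV)
  then have "x \<in> interior v" by (meson interior_maximal subsetD)
  with uv that show thesis by blast
qed

lemma compact_neighbourhood_of_compact:
  fixes C W :: "'x::t2_space set"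
  assumes lc: "locally compact (UNIV :: 'x set)" and C: "compact C" and W: "open W" "C \<subseteq> W"
  obtains K where "compact K" "C \<subseteq> interior K" "K \<subseteq> W"
proof -
  have "\<exists>K. compact K \<and> x \<in> interior K \<and> K \<subseteq> W" if "x \<in> C" for x
    using locally_compact_neighbourhood[OF lc W(1)] that W(2) by (metis subsetD)
  then obtain K where K: "compact (K x)" "x \<in> interior (K x)" "K x \<subseteq> W" if "x \<in> C" for x
    by metis
  obtain F where F: "F \<subseteq> C" "finite F" "C \<subseteq> (\<Union>x\<in>F. interior (K x))"
    by (rule compactE_image[OF C, of C "\<lambda>x. interior (K x)"]) (use K(2) in auto)
  show thesis
  proof (rule that[of "\<Union>x\<in>F. K x"])
    have "(\<Union>x\<in>F. interior (K x)) \<subseteq> interior (\<Union>x\<in>F. K x)"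
      by (intro UN_least interior_mono) auto
    then show "C \<subseteq> interior (\<Union>x\<in>F. K x)" using F(3) by blast
  qed (use F(1,2) K(1,3) in \<open>blast intro: compact_UN\<close>)+
qed

lemma locally_compact_cutoff:
  fixes C W :: "'x::t2_space set"
  assumes lc: "locally compact (UNIV :: 'x set)" and C: "compact C" and W: "open W" "C \<subseteq> W"
  obtains g :: "'x \<Rightarrow> real" where "continuous_on UNIV g" "\<And>x. 0 \<le> g x" "\<And>x. g x \<le> 1"
    "\<And>x. x \<in> C \<Longrightarrow> g x = 1" "\<And>x. x \<notin> W \<Longrightarrow> g x = 0"
proof -
  have "locally_compact_space (euclidean :: 'x topology)"
    unfolding locally_compact_space_def
    by (metis UNIV_I compactin_euclidean_iff interior_subset lc locally_compact_neighbourhood 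
        open_UNIV open_interior open_openin)
  moreover have "Hausdorff_space (euclidean :: 'x topology)"
    by (simp add: Hausdorff_space_def disjnt_def) (meson hausdorff)
  ultimately have "completely_regular_space (euclidean :: 'x topology)"
    using locally_compact_Hausdorff_imp_regular_space locally_compact_regular_imp_completely_regular_space by blast
  moreover have "disjnt C (- W)" using W(2) by (auto simp: disjnt_def)
  ultimately obtain g where g: "continuous_map (euclidean :: 'x topology) (subtopology euclidean {0..1::real}) g" 
      "g ` (- W) \<subseteq> {0}" "g ` C \<subseteq> {1}"
    using Urysohn_completely_regular_compact_closed[of 0 1 euclidean C "- W"] C W(1) by (auto simp: closed_Compl)
  show thesis
    by (rule that[of g]) (use g in \<open>auto simp: continuous_map_in_subtopology image_subset_iff Pi_iff\<close>)
qed

text \<open>Averaging cutoffs over \<open>N\<close> nested compact layers, each containing the \<open>R\<close>-neighbours of the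
  previous one, makes the variation along \<open>R\<close> at most \<open>2/N\<close>.\<close>
lemma slowly_varying_cutoff:
  fixes U C :: "'i \<Rightarrow> 'x::t2_space set" and R :: "'x \<Rightarrow> 'i \<Rightarrow> 'x \<Rightarrow> 'i \<Rightarrow> bool"
  assumes lc: "locally compact (UNIV :: 'x set)"
    and U: "\<And>b. b \<in> A \<Longrightarrow> open (U b)" and C: "\<And>b. b \<in> A \<Longrightarrow> compact (C b)" "\<And>b. b \<in> A \<Longrightarrow> C b \<subseteq> U b"
    and sym: "\<And>x b y b'. R x b y b' \<Longrightarrow> R y b' x b"
    and carry: "\<And>S. (\<And>b. b \<in> A \<Longrightarrow> compact (S b) \<and> S b \<subseteq> U b) \<Longrightarrow>
      \<exists>S'. \<forall>b\<in>A. compact (S' b) \<and> S' b \<subseteq> U b \<and> (\<forall>b'\<in>A. \<forall>x\<in>S b'. \<forall>y. R x b' y b \<longrightarrow> y \<in> S' b)"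
    and \<delta>: "0 < \<delta>"
  obtains h :: "'i \<Rightarrow> 'x \<Rightarrow> real" and S where 
    "\<And>b. b \<in> A \<Longrightarrow> continuous_on UNIV (h b)" "\<And>b x. 0 \<le> h b x" "\<And>b x. h b x \<le> 1"
    "\<And>b. b \<in> A \<Longrightarrow> compact (S b)" "\<And>b. b \<in> A \<Longrightarrow> S b \<subseteq> U b" 
    "\<And>b x. b \<in> A \<Longrightarrow> x \<notin> S b \<Longrightarrow> h b x = 0" "\<And>b x. b \<in> A \<Longrightarrow> x \<in> C b \<Longrightarrow> h b x = 1"
    "\<And>x b y b'. b \<in> A \<Longrightarrow> b' \<in> A \<Longrightarrow> x \<in> C b \<Longrightarrow> R x b y b' \<Longrightarrow> h b' y = 1"
    "\<And>x b y b'. b \<in> A \<Longrightarrow> b' \<in> A \<Longrightarrow> R x b y b' \<Longrightarrow> \<bar>h b x - h b' y\<bar> \<le> \<delta>"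
proof -
  let ?adm = "\<lambda>S. \<forall>b\<in>A. compact (S b) \<and> S b \<subseteq> U b"
  \<comment> \<open>A new layer must contain the old one in its interior, to leave room for a cutoff
    between them, and also all \<open>R\<close>-neighbours of the old one.\<close>
  have step: "\<exists>T. ?adm T \<and> (\<forall>b\<in>A. S b \<subseteq> interior (T b)) \<and> (\<forall>b\<in>A. \<forall>b'\<in>A. \<forall>x\<in>S b'. \<forall>y. R x b' y b \<longrightarrow> y \<in> T b)"
    if adm: "?adm S" for S
  proof -
    have "\<exists>S'. \<forall>b\<in>A. compact (S' b) \<and> S' b \<subseteq> U b \<and> (\<forall>b'\<in>A. \<forall>x\<in>S b'. \<forall>y. R x b' y b \<longrightarrow> y \<in> S' b)"
      by (rule carry) (use adm in blast)
    then obtain S' where S': "\<forall>b\<in>A. compact (S' b) \<and> S' b \<subseteq> U b \<and> (\<forall>b'\<in>A. \<forall>x\<in>S b'. \<forall>y. R x b' y b \<longrightarrow> y \<in> S' b)"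
      by (elim exE)
    have S: "compact (S b)" "S b \<subseteq> U b" and S'b: "compact (S' b)" "S' b \<subseteq> U b" if "b \<in> A" for b
      using bspec[OF adm that] bspec[OF S' that] by simp_all
    have "\<exists>T. compact T \<and> S b \<union> S' b \<subseteq> interior T \<and> T \<subseteq> U b" if "b \<in> A" for b
      by (rule compact_neighbourhood_of_compact[OF lc compact_Un[OF S(1)[OF that] S'b(1)[OF that]] U[OF that]])
        (use S(2)[OF that] S'b(2)[OF that] in auto)
    then obtain T where T: "compact (T b)" "S b \<union> S' b \<subseteq> interior (T b)" "T b \<subseteq> U b" if "b \<in> A" for b by metis
    have TS: "S b \<subseteq> interior (T b)" "S' b \<subseteq> T b" if "b \<in> A" for b
      using T(2)[OF that] interior_subset[of "T b"] by auto
    have "y \<in> T b" if "b \<in> A" "b' \<in> A" "x \<in> S b'" "R x b' y b" for b b' x y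
    proof -
      have "y \<in> S' b" using bspec[OF S' that(1)] that by metis
      then show ?thesis using TS(2)[OF that(1)] by (rule subsetD[rotated])
    qed
    then show ?thesis using T(1,3) TS(1) by (intro exI[of _ T]) simp
  qed
  have "\<exists>L. \<forall>n. (?adm (L n) \<and> (n = 0 \<longrightarrow> L n = C)) \<and>
     ((\<forall>b\<in>A. L n b \<subseteq> interior (L (Suc n) b)) \<and> (\<forall>b\<in>A. \<forall>b'\<in>A. \<forall>x\<in>L n b'. \<forall>y. R x b' y b \<longrightarrow> y \<in> L (Suc n) b))"
  proof (rule dependent_nat_choice)
    show "\<exists>S. ?adm S \<and> (0 = (0::nat) \<longrightarrow> S = C)" using C by simp
    fix S n assume "?adm S \<and> (n = (0::nat) \<longrightarrow> S = C)"
    then have "?adm S" by (rule conjunct1)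
    from step[OF this] obtain T where "?adm T" "\<forall>b\<in>A. S b \<subseteq> interior (T b)" 
        "\<forall>b\<in>A. \<forall>b'\<in>A. \<forall>x\<in>S b'. \<forall>y. R x b' y b \<longrightarrow> y \<in> T b"
      by (elim conjE exE)
    then show "\<exists>T. (?adm T \<and> (Suc n = 0 \<longrightarrow> T = C)) \<and>
        ((\<forall>b\<in>A. S b \<subseteq> interior (T b)) \<and> (\<forall>b\<in>A. \<forall>b'\<in>A. \<forall>x\<in>S b'. \<forall>y. R x b' y b \<longrightarrow> y \<in> T b))"
      by (intro exI[of _ T] conjI) simp_all
  qed
  then obtain L where Lraw: "\<forall>n. (?adm (L n) \<and> (n = 0 \<longrightarrow> L n = C)) \<and>
     ((\<forall>b\<in>A. L n b \<subseteq> interior (L (Suc n) b)) \<and> (\<forall>b\<in>A. \<forall>b'\<in>A. \<forall>x\<in>L n b'. \<forall>y. R x b' y b \<longrightarrow> y \<in> L (Suc n) b))"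
    by (elim exE)
  have L: "compact (L n b)" "L n b \<subseteq> U b" "L n b \<subseteq> interior (L (Suc n) b)" if "b \<in> A" for n b
    using spec[OF Lraw, of n] that by simp_all
  have L0: "L 0 = C" using spec[OF Lraw, of 0] by simp
  have LR: "y \<in> L (Suc n) b'" if "b \<in> A" "b' \<in> A" "x \<in> L n b" "R x b y b'" for n b b' x y
    using spec[OF Lraw, of n] that by meson
  have mono: "L n b \<subseteq> L m b" if "n \<le> m" "b \<in> A" for n m b
    using that(1)
    by (rule lift_Suc_mono_le[of "\<lambda>n. L n b", rotated]) (rule order_trans[OF L(3)[OF that(2)] interior_subset])
  have "\<exists>g::'x \<Rightarrow> real. continuous_on UNIV g \<and> (\<forall>x. 0 \<le> g x \<and> g x \<le> 1) \<and> 
      (\<forall>x\<in>L (Suc n) b. g x = 1) \<and> (\<forall>x. x \<notin> L (Suc (Suc n)) b \<longrightarrow> g x = 0)" if b: "b \<in> A" for n b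
  proof -
    obtain g :: "'x \<Rightarrow> real" where g: "continuous_on UNIV g" "\<And>x. 0 \<le> g x" "\<And>x. g x \<le> 1"
      "\<And>x. x \<in> L (Suc n) b \<Longrightarrow> g x = 1" "\<And>x. x \<notin> interior (L (Suc (Suc n)) b) \<Longrightarrow> g x = 0"
      by (rule locally_compact_cutoff[OF lc L(1)[OF b, of "Suc n"] open_interior L(3)[OF b, of "Suc n"]]) blast
    then show ?thesis using interior_subset by blast
  qed
  then have "\<exists>g. \<forall>n b. b \<in> A \<longrightarrow> continuous_on UNIV (g n b) \<and> (\<forall>x. 0 \<le> g n b x \<and> g n b x \<le> (1::real)) \<and> 
      (\<forall>x\<in>L (Suc n) b. g n b x = 1) \<and> (\<forall>x. x \<notin> L (Suc (Suc n)) b \<longrightarrow> g n b x = 0)"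
    by (subst choice_iff[symmetric])+ simp
  then obtain g where gall: "\<forall>n b. b \<in> A \<longrightarrow> continuous_on UNIV (g n b) \<and> (\<forall>x. 0 \<le> g n b x \<and> g n b x \<le> (1::real)) \<and> 
      (\<forall>x\<in>L (Suc n) b. g n b x = 1) \<and> (\<forall>x. x \<notin> L (Suc (Suc n)) b \<longrightarrow> g n b x = 0)"
    by (elim exE)
  have g: "continuous_on UNIV (g n b)" "\<And>x. 0 \<le> g n b x" "\<And>x. g n b x \<le> 1"
      "\<And>x. x \<in> L (Suc n) b \<Longrightarrow> g n b x = 1" "\<And>x. x \<notin> L (Suc (Suc n)) b \<Longrightarrow> g n b x = 0" if "b \<in> A" for n b
    using gall that by blast+
  obtain N :: nat where N: "2 / \<delta> < N" using reals_Archimedean2 by blast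
  have N0: "0 < N" using order_less_trans[OF divide_pos_pos[OF zero_less_numeral \<delta>] N] by simp
  then have N\<delta>: "2 / N \<le> \<delta>" using N \<delta> by (simp add: field_simps)
  define h where "h b x = (if b \<in> A then (\<Sum>n<N. g n b x) / N else 0)" for b x
  have var: "h b x - h b' y \<le> \<delta>" if R: "b \<in> A" "b' \<in> A" "R x b y b'" for b b' x y
  proof -
    \<comment> \<open>\<open>g n b\<close> vanishes off layer \<open>n + 2\<close>; the
      \<open>R\<close>-neighbours of that layer lie in layer \<open>n + 3\<close>, where
      \<open>g (n + 2) b'\<close> is 1. Shifting the index by two therefore dominates termwise and
      adds at most two terms, each at most 1.\<close>
    have "(\<Sum>n<N. g n b x) \<le> (\<Sum>n<N. g (n + 2) b' y)"
    proof (rule sum_mono)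
      fix n
      show "g n b x \<le> g (n + 2) b' y"
      proof (cases "x \<in> L (Suc (Suc n)) b")
        case True
        then have "y \<in> L (Suc (n + 2)) b'" using LR R by auto
        then show ?thesis using g(3,4) R by simp
      qed (use g(2,5) R in simp)
    qed
    also have "\<dots> = (\<Sum>n\<in>{2..<N+2}. g n b' y)"
      using sum.shift_bounds_nat_ivl[of "\<lambda>n. g n b' y" 0 2 N] by (simp only: lessThan_atLeast0 add_0)
    also have "\<dots> \<le> (\<Sum>n\<in>{..<N} \<union> {N, N+1}. g n b' y)"
      by (rule sum_mono2) (use g(2) R in auto)
    also have "\<dots> = (\<Sum>n<N. g n b' y) + (g N b' y + g (N + 1) b' y)"
      by (subst sum.union_disjoint) auto
    also have "\<dots> \<le> (\<Sum>n<N. g n b' y) + 2"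
      using g(3)[OF R(2), of N y] g(3)[OF R(2), of "N + 1" y] by simp
    finally have "(\<Sum>n<N. g n b x) / N \<le> ((\<Sum>n<N. g n b' y) + 2) / N" 
      by (rule divide_right_mono) simp
    then have "h b x - h b' y \<le> 2 / N" using R by (simp add: h_def add_divide_distrib)
    then show ?thesis using N\<delta> by simp
  qed
  show thesis
  proof (rule that[of h "L (Suc N)"])
    show "continuous_on UNIV (h b)" if "b \<in> A" for b
      unfolding h_def using that N0 g(1)[OF that] by (auto intro!: continuous_intros)
    show "0 \<le> h b x" for b x
      by (auto simp: h_def intro!: divide_nonneg_nonneg sum_nonneg g(2))
    show "h b x \<le> 1" for b x
    proof -
      have "(\<Sum>n<N. g n b x) \<le> N" if "b \<in> A" 
        using sum_bounded_above[of "{..<N}" "\<lambda>n. g n b x" 1] g(3)[OF that] by simp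
      then show ?thesis using N0 by (auto simp: h_def)
    qed
    show "h b x = 0" if "b \<in> A" "x \<notin> L (Suc N) b" for b x
    proof -
      have "g n b x = 0" if "n < N" for n
        using mono[of "Suc (Suc n)" "Suc N" b] that \<open>b \<in> A\<close> \<open>x \<notin> L (Suc N) b\<close> by (intro g(5)) auto
      then show ?thesis by (simp add: h_def)
    qed
    \<comment> \<open>Layer 1 contains \<open>C\<close> and all its \<open>R\<close>-neighbours, and
      every \<open>g n b\<close> is 1 there.\<close>
    have 1: "h b x = 1" if "b \<in> A" "x \<in> L 1 b" for b x
    proof -
      have "g n b x = 1" for n
        using mono[of 1 "Suc n" b] that by (intro g(4)) auto
      then show ?thesis using that N0 by (simp add: h_def)
    qed
    show "h b x = 1" if "b \<in> A" "x \<in> C b" for b x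
      using 1 mono[of 0 1 b] that L0 by auto
    show "h b' y = 1" if "b \<in> A" "b' \<in> A" "x \<in> C b" "R x b y b'" for x b y b'
      using 1 that L0 LR[of b b' x 0 y] by simp
    show "\<bar>h b x - h b' y\<bar> \<le> \<delta>" if "b \<in> A" "b' \<in> A" "R x b y b'" for x b y b'
      using var[OF that] var[OF that(2,1) sym[OF that(3)]] by simp
  qed (use L(1,2) in auto)
qed

section \<open>Expanding a product over subsets\<close>

lemma cell_tolerance:
  fixes \<epsilon> :: real
  assumes "0 < \<epsilon>" shows "\<exists>\<delta>>0. 2 ^ n * (real n * \<delta>) \<le> \<epsilon>"
proof -
  define k where "k = 2 ^ n * real n"
  have k: "0 \<le> k" by (simp add: k_def)
  \<comment> \<open>The added 1 covers \<open>n = 0\<close>, where \<open>k\<close>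
    vanishes.\<close>
  have "k * (\<epsilon> / (k + 1)) \<le> \<epsilon>" using assms k by (simp add: field_simps)
  moreover have "0 < \<epsilon> / (k + 1)" using assms k by (simp add: field_simps)
  ultimately show ?thesis unfolding k_def mult.assoc by blast
qed

text \<open>For values in the unit interval and \<open>J\<close> a subset of \<open>M\<close>, this
  is the probability that exactly the members of \<open>J\<close> occur among independent events of
  probabilities \<open>h m\<close>.\<close>

definition cell :: "'i set \<Rightarrow> ('i \<Rightarrow> real) \<Rightarrow> 'i set \<Rightarrow> real" where
  "cell M h J = (\<Prod>m\<in>M. if m \<in> J then h m else 1 - h m)"

lemma cell_nonneg: 
  assumes "\<And>m. m \<in> M \<Longrightarrow> 0 \<le> h m \<and> h m \<le> 1" shows "0 \<le> cell M h J"
  unfolding cell_def using assms by (intro prod_nonneg) auto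

lemma cell_sum:
  assumes M: "finite M" shows "(\<Sum>J\<in>Pow M. cell M h J) = 1"
proof -
  have "(\<Sum>J\<in>Pow M. cell M h J) = (\<Sum>J\<in>Pow M. (\<Prod>m\<in>J. h m) * (\<Prod>m\<in>M - J. 1 - h m))"
  proof (rule sum.cong[OF refl])
    fix J assume "J \<in> Pow M"
    then have J: "J \<subseteq> M" by simp
    have "cell M h J = (\<Prod>m\<in>J. if m \<in> J then h m else 1 - h m) * (\<Prod>m\<in>M - J. if m \<in> J then h m else 1 - h m)"
      unfolding cell_def by (subst mult.commute, rule prod.subset_diff[OF J M])
    also have "\<dots> = (\<Prod>m\<in>J. h m) * (\<Prod>m\<in>M - J. 1 - h m)"
      by (intro arg_cong2[where f = times] prod.cong) auto
    finally show "cell M h J = (\<Prod>m\<in>J. h m) * (\<Prod>m\<in>M - J. 1 - h m)" .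
  qed
  also have "\<dots> = (\<Prod>m\<in>M. h m + (1 - h m))" by (rule prod_add[OF M, symmetric])
  finally show ?thesis by simp
qed

text \<open>Used contrapositively: it reads off from a nonzero weight which cutoffs must, and which
  cannot, be active.\<close>

lemma cell_eq_0:
  assumes "finite M" "m \<in> M" "m \<in> J \<and> h m = 0 \<or> m \<notin> J \<and> h m = 1"
  shows "cell M h J = 0"
  unfolding cell_def by (rule prod_zero) (use assms in auto)

text \<open>A crude bound suffices: each of the \<open>2 ^ card M\<close> products has factors in
  the unit interval, so it changes by at most \<open>\<delta>\<close> per factor.\<close>

lemma cell_diff:
  fixes \<delta> :: real
  assumes M: "finite M" and h: "\<And>m. m \<in> M \<Longrightarrow> 0 \<le> h m \<and> h m \<le> 1" and k: "\<And>m. m \<in> M \<Longrightarrow> 0 \<le> k m \<and> k m \<le> 1"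
    and \<delta>: "\<And>m. m \<in> M \<Longrightarrow> \<bar>h m - k m\<bar> \<le> \<delta>"
  shows "(\<Sum>J\<in>Pow M. \<bar>cell M h J - cell M k J\<bar>) \<le> 2 ^ card M * (card M * \<delta>)"
proof -
  have "\<bar>cell M h J - cell M k J\<bar> \<le> card M * \<delta>" for J
  proof -
    have "\<bar>cell M h J - cell M k J\<bar> \<le> (\<Sum>m\<in>M. \<bar>(if m \<in> J then h m else 1 - h m) - (if m \<in> J then k m else 1 - k m)\<bar>)"
      unfolding cell_def real_norm_def[symmetric] by (rule norm_prod_diff) (use h k in auto)
    also have "\<dots> \<le> (\<Sum>m\<in>M. \<delta>)"
      using \<delta> by (intro sum_mono) (auto simp: abs_minus_commute)
    finally show ?thesis by simp
  qed
  then have "(\<Sum>J\<in>Pow M. \<bar>cell M h J - cell M k J\<bar>) \<le> (\<Sum>J\<in>Pow M. card M * \<delta>)"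
    by (intro sum_mono) 
  then show ?thesis using M by (simp add: card_Pow)
qed

section \<open>Saturations in the skew product\<close>

locale sdp_action =
  fixes P :: "'q::group_add set" and D :: "('x::{t2_space,second_countable_topology} \<times> 'q) set"
    and act :: "'x \<Rightarrow> 'q \<Rightarrow> 'x"
  assumes subsemigroup: "subsemigroup P" and partial_action: "partial_action P D act"
    and directed: "directed_action P D" and locally_compact_action: "locally_compact_action P D act"
begin

section \<open>Calculus of moves\<close>

lemma zero_in_P: "0 \<in> P" and add_in_P: "m \<in> P \<Longrightarrow> n \<in> P \<Longrightarrow> m + n \<in> P"
  using subsemigroup by (auto simp: subsemigroup_def)

lemma in_P: "(x, m) \<in> D \<Longrightarrow> m \<in> P"
  using partial_action by (auto simp: partial_action_def)

lemma zero_in_D: "(x, 0) \<in> D" and act_zero: "act x 0 = x"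
  using partial_action by (auto simp: partial_action_def)

lemma add_in_D_iff: "m \<in> P \<Longrightarrow> n \<in> P \<Longrightarrow> (x, m + n) \<in> D \<longleftrightarrow> (x, m) \<in> D \<and> (act x m, n) \<in> D"
  using partial_action by (simp add: partial_action_def)

lemma act_add: "m \<in> P \<Longrightarrow> n \<in> P \<Longrightarrow> (x, m + n) \<in> D \<Longrightarrow> act (act x m) n = act x (m + n)"
  using partial_action by (simp add: partial_action_def)

text \<open>Confluence: two moves of one point prolong to the same group element, hence to the same
  target. This makes the eventual meeting of orbits a transitive relation.\<close>

lemma common_move:
  assumes "(x, m) \<in> D" "(x, n) \<in> D"
  obtains s t where "s \<in> P" "t \<in> P" "m + s = n + t" "(x, m + s) \<in> D"
proof -
  have "x \<in> Udom D m \<inter> Udom D n" using assms by (simp add: Udom_def)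
  then obtain r where r: "semigroup_le P m r" "semigroup_le P n r" "Udom D m \<inter> Udom D n = Udom D r"
    using directed in_P[OF assms(1)] in_P[OF assms(2)] unfolding directed_action_def by blast
  then show thesis
    using that \<open>x \<in> Udom D m \<inter> Udom D n\<close> unfolding semigroup_le_def Udom_def by auto
qed

lemma move_along:
  assumes "(x, m) \<in> D" "(y, n) \<in> D" "act x m = act y n" "s \<in> P" "(x, m + s) \<in> D"
  shows "(y, n + s) \<in> D" "act y (n + s) = act x (m + s)"
proof -
  show yD: "(y, n + s) \<in> D"
    using assms add_in_D_iff[OF in_P[OF assms(1)] assms(4)] add_in_D_iff[OF in_P[OF assms(2)] assms(4)] by auto
  show "act y (n + s) = act x (m + s)"
    using act_add[OF in_P[OF assms(1)] assms(4,5)] act_add[OF in_P[OF assms(2)] assms(4) yD] assms(3) by simp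
qed

lemma open_Udom: "m \<in> P \<Longrightarrow> open (Udom D m)" and open_Vran: "m \<in> P \<Longrightarrow> open (Vran D act m)"
  and locally_compact: "locally compact (UNIV :: 'x set)"
  using locally_compact_action by (auto simp: locally_compact_action_def)

lemma continuous_on_act:
  assumes "m \<in> P"
  shows "continuous_on (Udom D m) (\<lambda>x. act x m)"
proof (rule continuous_at_imp_continuous_on, rule ballI)
  fix x assume "x \<in> Udom D m"
  moreover have "local_homeomorphism (Udom D m) (Vran D act m) (\<lambda>x. act x m)"
    using locally_compact_action assms by (simp add: locally_compact_action_def)
  ultimately obtain W where W: "open W" "x \<in> W" "continuous_on W (\<lambda>x. act x m)"
    unfolding local_homeomorphism_def homeomorphism_def by metis
  then show "isCont (\<lambda>x. act x m) x" by (simp add: continuous_on_eq_continuous_at)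
qed

text \<open>A point \<open>x\<close> at level \<open>b\<close> stands for \<open>(x, b)\<close> in the skew product \<open>X \<times> Q\<close>, where moving by
  \<open>m\<close> leads to \<open>(act x m, b + m)\<close>. Then \<open>reach a m b\<close> is the slice at level \<open>b\<close> of the saturation of
  \<open>Udom D m \<times> {a}\<close>; the two orbits may be required to meet beyond \<open>m\<close> because the action is directed.\<close>
definition reach :: "'q \<Rightarrow> 'q \<Rightarrow> 'q \<Rightarrow> 'x set" where
  "reach a m b = {x. \<exists>s\<in>P. \<exists>w z. b + w = a + (m + s) \<and> (x, w) \<in> D \<and> (z, m + s) \<in> D \<and> act x w = act z (m + s)}"

lemma reachI:
  "s \<in> P \<Longrightarrow> b + w = a + (m + s) \<Longrightarrow> (x, w) \<in> D \<Longrightarrow> (z, m + s) \<in> D \<Longrightarrow> act x w = act z (m + s) \<Longrightarrow> x \<in> reach a m b"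
  by (auto simp: reach_def)

lemma reachE:
  assumes "x \<in> reach a m b"
  obtains s w z where "s \<in> P" "b + w = a + (m + s)" "(x, w) \<in> D" "(z, m + s) \<in> D" "act x w = act z (m + s)"
  using assms by (auto simp: reach_def)

text \<open>The witness \<open>z\<close> enters only through the open set
  \<open>Vran D act (m + s)\<close>, so the slice is a union of preimages of open sets under
  moves.\<close>

lemma open_reach:
  assumes "m \<in> P" shows "open (reach a m b)"
proof -
  let ?B = "{(s, w). s \<in> P \<and> w \<in> P \<and> b + w = a + (m + s)}"
  have "reach a m b = (\<Union>(s, w)\<in>?B. Udom D w \<inter> (\<lambda>x. act x w) -` Vran D act (m + s))"
    by (auto simp: reach_def Udom_def Vran_def intro: in_P)
  moreover have "open (Udom D w \<inter> (\<lambda>x. act x w) -` Vran D act (m + s))" if "s \<in> P" "w \<in> P" for s w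
    using that assms by (intro continuous_open_preimage continuous_on_act open_Udom open_Vran add_in_P)
  ultimately show ?thesis by auto
qed

lemma reach_self: "x \<in> reach a 0 a"
  by (rule reachI[of 0 _ 0 _ _ _ x]) (auto simp: zero_in_P zero_in_D)

text \<open>The move of \<open>x\<close> that witnesses \<open>reach\<close> and the one that links
  it to \<open>y\<close> are prolonged to a common move; \<open>z\<close> and \<open>y\<close> are
  then carried along the same prolongations.\<close>

lemma reach_invariant:
  assumes "x \<in> reach a m b" and m: "m \<in> P" and xy: "(x, k) \<in> D" "(y, l) \<in> D" "act x k = act y l" "b + k = b' + l"
  shows "y \<in> reach a m b'"
proof -
  obtain s w z where w: "s \<in> P" "b + w = a + (m + s)" "(x, w) \<in> D" "(z, m + s) \<in> D" "act x w = act z (m + s)"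
    using assms(1) by (rule reachE)
  obtain t t' where t: "t \<in> P" "t' \<in> P" "w + t = k + t'" "(x, w + t) \<in> D"
    using common_move[OF w(3) xy(1)] .
  have z: "(z, m + s + t) \<in> D" "act z (m + s + t) = act x (w + t)"
    using move_along[OF w(3,4,5) t(1,4)] .
  have y: "(y, l + t') \<in> D" "act y (l + t') = act x (k + t')"
    using move_along[OF xy(1-3) t(2)] t(3,4) by simp_all
  show ?thesis
  proof (rule reachI)
    show "s + t \<in> P" using w t add_in_P by blast
    have "b' + (l + t') = b + (w + t)" using t(3) xy(4) by (metis add.assoc)
    then show "b' + (l + t') = a + (m + (s + t))" using w(2) by (metis add.assoc)
    show "(y, l + t') \<in> D" by (rule y(1))
    show "(z, m + (s + t)) \<in> D" using z(1) by (simp only: add.assoc)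
    show "act y (l + t') = act z (m + (s + t))" using y(2) z(2) t(3) by (simp only: add.assoc)
  qed
qed

text \<open>The witness \<open>z\<close> for \<open>m0\<close> serves every \<open>m\<close> in
  \<open>J\<close>. A common prolongation at \<open>x\<close> carries \<open>z\<close> to a level
  that also has the form \<open>a + (m + _)\<close>; cancelling \<open>a\<close> shows that
  \<open>z\<close> admits a move starting with \<open>m\<close>. This is why the reference level is
  the same for all \<open>m\<close>.\<close>

lemma reach_common_point:
  assumes J: "J \<subseteq> P" "m0 \<in> J" and x: "\<And>m. m \<in> J \<Longrightarrow> x \<in> reach a m b"
  obtains s w z where "s \<in> P" "b + w = a + (m0 + s)" "(x, w) \<in> D" "(z, m0 + s) \<in> D" "act x w = act z (m0 + s)"
    "\<And>m. m \<in> J \<Longrightarrow> (z, m) \<in> D"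
proof -
  obtain s w z where w: "s \<in> P" "b + w = a + (m0 + s)" "(x, w) \<in> D" "(z, m0 + s) \<in> D" "act x w = act z (m0 + s)"
    using x[OF J(2)] by (rule reachE)
  have "(z, m) \<in> D" if m: "m \<in> J" for m
  proof -
    obtain s' w' z' where w': "s' \<in> P" "b + w' = a + (m + s')" "(x, w') \<in> D"
      using x[OF m] by (rule reachE)
    obtain t t' where t: "t \<in> P" "t' \<in> P" "w + t = w' + t'" "(x, w + t) \<in> D"
      using common_move[OF w(3) w'(3)] .
    have z: "(z, m0 + s + t) \<in> D" using move_along[OF w(3,4,5) t(1,4)] by simp
    have "a + (m0 + s + t) = b + (w + t)" using w(2) by (metis add.assoc)
    also have "\<dots> = a + (m + (s' + t'))" using t(3) w'(2) by (metis add.assoc)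
    finally have "(z, m + (s' + t')) \<in> D" using z by simp
    then show ?thesis using add_in_D_iff m J(1) w'(1) t(2) add_in_P by blast
  qed
  with w that show thesis by blast
qed

text \<open>The point \<open>z\<close> keeps all intersections nonempty, as directedness requires.
  Because directedness compares whole domains, the bound found through \<open>z\<close> serves every
  point of the intersection.\<close>

lemma finite_directed:
  assumes "finite J" "J \<noteq> {}" "J \<subseteq> P" "\<And>m. m \<in> J \<Longrightarrow> (z, m) \<in> D"
  shows "\<exists>r\<in>P. (\<forall>m\<in>J. semigroup_le P m r) \<and> (\<forall>z. (\<forall>m\<in>J. (z, m) \<in> D) \<longrightarrow> (z, r) \<in> D)"
  using assms
proof (induction J rule: finite_ne_induct)
  case (singleton m)
  then show ?case using zero_in_P by (intro bexI[of _ m]) (auto simp: semigroup_le_def intro: bexI[of _ 0])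
next
  case (insert m J)
  then obtain r where r: "r \<in> P" "\<forall>m\<in>J. semigroup_le P m r" "\<forall>z. (\<forall>m\<in>J. (z, m) \<in> D) \<longrightarrow> (z, r) \<in> D" by auto
  have "z \<in> Udom D m \<inter> Udom D r" using insert.prems r(3) by (auto simp: Udom_def)
  then obtain r' where r': "r' \<in> P" "semigroup_le P m r'" "semigroup_le P r r'" "Udom D m \<inter> Udom D r = Udom D r'"
    using directed r(1) insert.prems(1) unfolding directed_action_def by blast
  have "semigroup_le P k r'" if "k \<in> J" for k
    using r(2) that r'(3) add_in_P unfolding semigroup_le_def by (metis add.assoc)
  moreover have "(z, r') \<in> D" if "\<forall>m\<in>insert m J. (z, m) \<in> D" for z
    using r(3) that r'(4) by (auto simp: Udom_def)
  ultimately show ?case using r' by auto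
qed

text \<open>The choice depends on \<open>J\<close> alone, so that linked points with the same active
  set are sent to the same level.\<close>

definition top_of :: "'q set \<Rightarrow> 'q" where
  "top_of J = (SOME r. r \<in> P \<and> (\<forall>m\<in>J. semigroup_le P m r) \<and> (\<forall>z. (\<forall>m\<in>J. (z, m) \<in> D) \<longrightarrow> (z, r) \<in> D))"

text \<open>The common witness \<open>z\<close> lies in the domain of \<open>top_of J\<close>;
  confluence at \<open>z\<close> joins its move by \<open>m0 + s\<close> with a move beyond
  \<open>top_of J\<close>, and \<open>x\<close> follows.\<close>

lemma reach_top_of:
  assumes J: "finite J" "J \<noteq> {}" "J \<subseteq> P" and x: "\<And>m. m \<in> J \<Longrightarrow> x \<in> reach a m b"
  shows "\<And>m. m \<in> J \<Longrightarrow> semigroup_le P m (top_of J)" "x \<in> reach a (top_of J) b"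
proof -
  obtain m0 where m0: "m0 \<in> J" using J(2) by blast
  obtain s w z where w: "s \<in> P" "b + w = a + (m0 + s)" "(x, w) \<in> D" "(z, m0 + s) \<in> D" "act x w = act z (m0 + s)"
    and zJ: "\<And>m. m \<in> J \<Longrightarrow> (z, m) \<in> D"
    by (rule reach_common_point[OF J(3) m0 x]) blast+
  have "\<exists>r. r \<in> P \<and> (\<forall>m\<in>J. semigroup_le P m r) \<and> (\<forall>z. (\<forall>m\<in>J. (z, m) \<in> D) \<longrightarrow> (z, r) \<in> D)"
    using finite_directed[OF J zJ] by blast
  then have top: "top_of J \<in> P" "\<forall>m\<in>J. semigroup_le P m (top_of J)" "\<forall>z. (\<forall>m\<in>J. (z, m) \<in> D) \<longrightarrow> (z, top_of J) \<in> D"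
    unfolding top_of_def by (smt (verit, best) someI_ex)+
  show "\<And>m. m \<in> J \<Longrightarrow> semigroup_le P m (top_of J)" using top(2) by blast
  have "(z, top_of J) \<in> D" using top(3) zJ by blast
  from common_move[OF w(4) this] obtain t s' where t: "t \<in> P" "s' \<in> P" "m0 + s + t = top_of J + s'" "(z, m0 + s + t) \<in> D" .
  show "x \<in> reach a (top_of J) b"
  proof (rule reachI[OF t(2)])
    show "(x, w + t) \<in> D" "act x (w + t) = act z (top_of J + s')"
      using move_along[OF w(4,3) w(5)[symmetric] t(1,4)] t(3) by simp_all
    show "b + (w + t) = a + (top_of J + s')" using w(2) t(3) by (metis add.assoc)
  qed (use t in simp)
qed

text \<open>Turns membership in a saturation into an actual move, given the anchor \<open>u\<close>.
  With \<open>r = m + p\<close>, the move \<open>w\<close> of \<open>x\<close> factors as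
  \<open>u + p + s\<close>; since \<open>u\<close>, \<open>p\<close> and \<open>s\<close> all lie in
  \<open>P\<close>, the initial part \<open>u + p\<close> is defined at \<open>x\<close>.\<close>

lemma reach_imp_move:
  assumes "x \<in> reach a r b" "semigroup_le P m r" "(x, u) \<in> D" "b + u = a + m"
  obtains p where "p \<in> P" "r = m + p" "(x, u + p) \<in> D" "u + p = - b + (a + r)"
proof -
  obtain p where p: "p \<in> P" "r = m + p" using assms(2) by (auto simp: semigroup_le_def)
  obtain s w where w: "s \<in> P" "b + w = a + (r + s)" "(x, w) \<in> D" using assms(1) by (rule reachE)
  have up: "b + (u + p) = a + r" using p(2) assms(4) by (metis add.assoc)
  then have "b + (u + p + s) = b + w" using w(2) by (metis add.assoc)
  then have "(x, u + p + s) \<in> D" using w(3) by simp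
  then have "(x, u + p) \<in> D" using add_in_D_iff add_in_P in_P assms(3) p(1) w(1) by blast
  moreover have "u + p = - b + (a + r)" using up by (metis add.assoc add.left_inverse add_0)
  ultimately show thesis using that p by blast
qed

section \<open>Finite families of anchors\<close>

text \<open>Produces the anchors \<open>u\<close>. Near each point, its move witnessing
  \<open>reach\<close> and its move by \<open>n\<close> have a common prolongation \<open>u\<close>,
  which lies beyond \<open>n\<close> and ends at a level \<open>a + m\<close>; both conditions are
  open, so compactness leaves finitely many \<open>m\<close>.\<close>

lemma cover_by_moves:
  assumes S: "compact S" "S \<subseteq> Udom D n" "S \<subseteq> reach a 0 b"
  shows "\<exists>M E. finite M \<and> M \<subseteq> P \<and> (\<forall>m\<in>M. compact (E m) \<and> E m \<subseteq> reach a m b) \<and>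
    (\<forall>x\<in>S. \<exists>m\<in>M. \<exists>u. x \<in> interior (E m) \<and> b + u = a + m \<and> semigroup_le P n u \<and> (x, u) \<in> D)"
proof -
  have "\<exists>m K. m \<in> P \<and> compact K \<and> x \<in> interior K \<and> K \<subseteq> reach a m b \<and> 
      (\<exists>u. b + u = a + m \<and> semigroup_le P n u \<and> K \<subseteq> Udom D u)" if x: "x \<in> S" for x
  proof -
    have xn: "(x, n) \<in> D" using S(2) x by (auto simp: Udom_def)
    obtain s w z where w: "s \<in> P" "b + w = a + (0 + s)" "(x, w) \<in> D" "(z, 0 + s) \<in> D" "act x w = act z (0 + s)"
      using S(3) x by (blast elim: reachE)
    obtain t t' where t: "t \<in> P" "t' \<in> P" "w + t = n + t'" "(x, w + t) \<in> D"
      using common_move[OF w(3) xn] .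
    have m: "s + t \<in> P" using w t add_in_P by blast
    have bw: "b + (w + t) = a + (s + t)" using w(2) by (metis add.assoc add_0)
    have "x \<in> reach a (s + t) b"
      by (rule reachI[OF zero_in_P, of _ "w + t" _ _ _ z])
        (use move_along[OF w(3-5) t(1,4)] t(4) bw in simp_all)
    then have "x \<in> reach a (s + t) b \<inter> Udom D (w + t)" using t(4) by (simp add: Udom_def)
    moreover have "open (reach a (s + t) b \<inter> Udom D (w + t))"
      using m open_reach open_Udom in_P[OF t(4)] by blast
    ultimately obtain K where "compact K" "x \<in> interior K" "K \<subseteq> reach a (s + t) b \<inter> Udom D (w + t)"
      using locally_compact_neighbourhood[OF locally_compact] by metis
    then show ?thesis using m bw t(2,3) unfolding semigroup_le_def by (metis le_inf_iff)
  qed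
  then obtain m K where K: "\<And>x. x \<in> S \<Longrightarrow> m x \<in> P" "\<And>x. x \<in> S \<Longrightarrow> compact (K x)" "\<And>x. x \<in> S \<Longrightarrow> x \<in> interior (K x)"
      "\<And>x. x \<in> S \<Longrightarrow> K x \<subseteq> reach a (m x) b" 
      "\<And>x. x \<in> S \<Longrightarrow> \<exists>u. b + u = a + m x \<and> semigroup_le P n u \<and> K x \<subseteq> Udom D u"
    by metis
  obtain F where F: "F \<subseteq> S" "finite F" "S \<subseteq> (\<Union>x\<in>F. interior (K x))"
    by (rule compactE_image[OF S(1), of S "\<lambda>x. interior (K x)"]) (use K(3) in auto)
  \<comment> \<open>Different centres may share the same \<open>m\<close>; their neighbourhoods are
    merged so that a piece depends on \<open>m\<close> only.\<close>
  let ?E = "\<lambda>k. \<Union>x\<in>{x\<in>F. m x = k}. K x"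
  show ?thesis
  proof (intro exI[of _ "m ` F"] exI[of _ ?E] conjI ballI)
    fix y assume "y \<in> S"
    then obtain x where x: "x \<in> F" "y \<in> interior (K x)" using F(3) by blast
    then obtain u where u: "b + u = a + m x" "semigroup_le P n u" "K x \<subseteq> Udom D u" using K(5) F(1) by blast
    have "interior (K x) \<subseteq> interior (?E (m x))" using x(1) by (intro interior_mono) blast
    then have "y \<in> interior (?E (m x))" using x(2) by blast
    moreover have "(y, u) \<in> D" using u(3) x(2) interior_subset by (fastforce simp: Udom_def)
    ultimately show "\<exists>k\<in>m ` F. \<exists>u. y \<in> interior (?E k) \<and> b + u = a + k \<and> semigroup_le P n u \<and> (y, u) \<in> D"
      using x(1) u(1,2) by blast
  next
    show "?E k \<subseteq> reach a k b" for k using K(4) F(1) by blast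
    show "compact (?E k)" for k using K(2) F(1,2) by (intro compact_UN) auto
  qed (use F K(1) in auto)
qed

text \<open>One index set \<open>M\<close> must serve all levels in \<open>A\<close>, because cells
  at different levels are compared term by term.\<close>

lemma cover_by_moves_family:
  assumes A: "finite A" and I: "finite I" "\<And>n C. (n, C) \<in> I \<Longrightarrow> closed C \<and> C \<subseteq> Udom D n"
    and S: "\<And>b. b \<in> A \<Longrightarrow> compact (S b)" "\<And>b. b \<in> A \<Longrightarrow> S b \<subseteq> reach a 0 b"
  shows "\<exists>M E. finite M \<and> M \<subseteq> P \<and> (\<forall>m\<in>M. \<forall>b\<in>A. compact (E m b) \<and> E m b \<subseteq> reach a m b) \<and>
    (\<forall>(n, C)\<in>I. \<forall>b\<in>A. \<forall>x\<in>S b \<inter> C. \<exists>m\<in>M. \<exists>u. x \<in> interior (E m b) \<and> b + u = a + m \<and> semigroup_le P n u \<and> (x, u) \<in> D)"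
proof -
  define Q where "Q b n C M E \<longleftrightarrow> finite M \<and> M \<subseteq> P \<and> (\<forall>m\<in>M. compact (E m) \<and> E m \<subseteq> reach a m b) \<and>
    (\<forall>x\<in>S b \<inter> C. \<exists>m\<in>M. \<exists>u. x \<in> interior (E m) \<and> b + u = a + m \<and> semigroup_le P n u \<and> (x, u) \<in> D)"
    for b n C M E
  have "\<exists>M E. Q b n C M E" if "b \<in> A" "(n, C) \<in> I" for b n C
    unfolding Q_def by (rule cover_by_moves) (use that S I(2) in \<open>blast intro: compact_Int_closed\<close>)+
  then obtain M' E' where Q: "\<And>b n C. b \<in> A \<Longrightarrow> (n, C) \<in> I \<Longrightarrow> Q b n C (M' b n C) (E' b n C)"
    by metis
  define M where "M i = M' (fst i) (fst (snd i)) (snd (snd i))" for i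
  define E where "E i = E' (fst i) (fst (snd i)) (snd (snd i))" for i
  have ME: "\<forall>i\<in>A \<times> I. finite (M i) \<and> M i \<subseteq> P \<and> (\<forall>m\<in>M i. compact (E i m) \<and> E i m \<subseteq> reach a m (fst i)) \<and>
    (\<forall>x\<in>S (fst i) \<inter> snd (snd i). \<exists>m\<in>M i. \<exists>u. x \<in> interior (E i m) \<and> fst i + u = a + m \<and> semigroup_le P (fst (snd i)) u \<and> (x, u) \<in> D)"
    unfolding M_def E_def using Q[unfolded Q_def] by simp
  let ?M = "\<Union>i\<in>A \<times> I. M i" and ?E = "\<lambda>m b. \<Union>j\<in>{j\<in>I. m \<in> M (b, j)}. E (b, j) m"
  show ?thesis
  proof (intro exI[of _ ?M] exI[of _ ?E] conjI ballI, goal_cases)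
    case 1 show ?case using A I(1) ME by blast
  next
    case 2 show ?case using ME by blast
  next
    case (3 m b) show ?case using ME I(1) 3 by (intro compact_UN) auto
  next
    case (4 m b) then show ?case using ME by fastforce
  next
    case (5 j)
    show ?case
    proof (clarify)
      fix n C b x assume j: "j = (n, C)" and b: "b \<in> A" and x: "x \<in> S b" "x \<in> C"
      have jI: "(b, j) \<in> A \<times> I" using 5 b by simp
      have "\<forall>x\<in>S b \<inter> C. \<exists>m\<in>M (b, j). \<exists>u. x \<in> interior (E (b, j) m) \<and> b + u = a + m \<and> semigroup_le P n u \<and> (x, u) \<in> D"
        using bspec[OF ME jI] unfolding j by simp
      then obtain m u where m: "m \<in> M (b, j)" "x \<in> interior (E (b, j) m)" "b + u = a + m" "semigroup_le P n u" "(x, u) \<in> D"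
        using x by blast
      have "interior (E (b, j) m) \<subseteq> interior (?E m b)" using m(1) 5 by (intro interior_mono) blast
      then show "\<exists>m\<in>?M. \<exists>u. x \<in> interior (?E m b) \<and> b + u = a + m \<and> semigroup_le P n u \<and> (x, u) \<in> D"
        using m jI by blast
    qed
  qed
qed

end

section \<open>Almost invariant forward moves\<close>

text \<open>\<open>K\<close> will describe a compact set of arrows by finitely many compact pieces,
  closed under inversion; \<open>A\<close> will be the support of the weight on the group.\<close>

locale sdp_links = sdp_action P D act
  for P :: "'q::group_add set" and D :: "('x::{t2_space,second_countable_topology} \<times> 'q) set"
    and act :: "'x \<Rightarrow> 'q \<Rightarrow> 'x" +
  fixes K :: "('q \<times> 'q \<times> 'x set \<times> 'x set) set" and A :: "'q set"
  assumes finite_K: "finite K" and finite_A: "finite A"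
    and K: "(m, n, C, C') \<in> K \<Longrightarrow> m \<in> P \<and> n \<in> P \<and> compact C \<and> compact C' \<and> C \<subseteq> Udom D m \<and> C' \<subseteq> Udom D n"
    and K_sym: "(m, n, C, C') \<in> K \<Longrightarrow> (n, m, C', C) \<in> K"
begin

text \<open>The arrow \<open>(x, m + - n, y)\<close> lifts to an arrow between \<open>(x, b)\<close>
  and \<open>(y, b')\<close> in the skew product exactly when \<open>b + m = b' + n\<close>.\<close>

definition linked :: "'x \<Rightarrow> 'q \<Rightarrow> 'x \<Rightarrow> 'q \<Rightarrow> bool" where
  "linked x b y b' \<longleftrightarrow> (\<exists>(m, n, C, C')\<in>K. x \<in> C \<and> y \<in> C' \<and> act x m = act y n \<and> b + m = b' + n)"

lemma linkedE:
  assumes "linked x b y b'"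
  obtains m n C C' where "(m, n, C, C') \<in> K" "x \<in> C" "y \<in> C'" "(x, m) \<in> D" "(y, n) \<in> D" "act x m = act y n" "b + m = b' + n"
proof -
  obtain m n C C' where *: "(m, n, C, C') \<in> K" "x \<in> C" "y \<in> C'" "act x m = act y n" "b + m = b' + n"
    using assms by (auto simp: linked_def)
  then show thesis using that[OF *(1-3) _ _ *(4,5)] K[OF *(1)] by (auto simp: Udom_def)
qed

lemma linked_sym: 
  assumes "linked x b y b'" shows "linked y b' x b"
proof -
  obtain m n C C' where *: "(m, n, C, C') \<in> K" "x \<in> C" "y \<in> C'" "act x m = act y n" "b + m = b' + n"
    using assms by (rule linkedE)
  show ?thesis
    unfolding linked_def by (rule bexI[OF _ K_sym[OF *(1)]]) (use * in simp)
qed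

text \<open>Provides the hypothesis \<open>carry\<close> of \<open>slowly_varying_cutoff\<close>.
  Points linked to a compact set form finitely many sets, each the preimage in \<open>C'\<close> of
  the image of a compact set; invariance keeps them inside the saturation.\<close>

lemma linked_compact:
  assumes m: "m \<in> P" and S: "\<And>b. b \<in> A \<Longrightarrow> compact (S b) \<and> S b \<subseteq> reach a m b"
  shows "\<exists>S'. \<forall>b\<in>A. compact (S' b) \<and> S' b \<subseteq> reach a m b \<and> 
    (\<forall>b'\<in>A. \<forall>x\<in>S b'. \<forall>y. linked x b' y b \<longrightarrow> y \<in> S' b)"
proof -
  define T where "T b i = (case i of (b', k, l, C, C') \<Rightarrow> 
     C' \<inter> (\<lambda>y. act y l) -` ((\<lambda>x. act x k) ` (S b' \<inter> C)))" for b :: 'q and i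
  define I where "I b = {i \<in> A \<times> K. case i of (b', k, l, C, C') \<Rightarrow> b' + k = b + l}" for b
  have I: "finite (I b)" for b unfolding I_def using finite_A finite_K by simp
  have "compact (T b i)" if i: "i \<in> I b" for b i
  proof -
    obtain b' k l C C' where e: "i = (b', k, l, C, C')" by (metis prod_cases5)
    have b': "b' \<in> A" "(k, l, C, C') \<in> K" using i by (auto simp: I_def e)
    note KK = K[OF b'(2)]
    have "compact (S b' \<inter> C)" using S[OF b'(1)] KK by (simp add: compact_Int)
    moreover have "continuous_on (S b' \<inter> C) (\<lambda>x. act x k)"
      using continuous_on_subset[OF continuous_on_act] KK by blast
    ultimately have "closed ((\<lambda>x. act x k) ` (S b' \<inter> C))"
      by (intro compact_imp_closed compact_continuous_image)
    moreover have "continuous_on C' (\<lambda>y. act y l)"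
      using continuous_on_subset[OF continuous_on_act] KK by blast
    ultimately have "closed (T b i)" unfolding T_def e prod.case
      using KK compact_imp_closed by (intro continuous_closed_preimage) auto
    then have "compact (C' \<inter> T b i)" using KK by (intro compact_Int_closed) auto
    moreover have "C' \<inter> T b i = T b i" by (auto simp: T_def e)
    ultimately show ?thesis by simp
  qed
  moreover have "T b i \<subseteq> reach a m b" if i: "i \<in> I b" for b i
  proof
    fix y assume y: "y \<in> T b i"
    obtain b' k l C C' where e: "i = (b', k, l, C, C')" by (metis prod_cases5)
    have b': "b' \<in> A" "(k, l, C, C') \<in> K" "b' + k = b + l" using i by (auto simp: I_def e)
    obtain x where x: "x \<in> S b'" "x \<in> C" "y \<in> C'" "act x k = act y l" using y by (auto simp: T_def e)
    show "y \<in> reach a m b"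
      by (rule reach_invariant[OF _ m _ _ x(4) b'(3)]) (use S[OF b'(1)] K[OF b'(2)] x in \<open>auto simp: Udom_def\<close>)
  qed
  moreover have "y \<in> (\<Union>i\<in>I b. T b i)" if bb: "b \<in> A" "b' \<in> A" "x \<in> S b'" "linked x b' y b" for b b' x y
  proof -
    obtain k l C C' where l: "(k, l, C, C') \<in> K" "x \<in> C" "y \<in> C'" "act x k = act y l" "b' + k = b + l"
      using bb(4) by (rule linkedE)
    then have "(b', k, l, C, C') \<in> I b" using bb(2) by (simp add: I_def)
    moreover have "y \<in> T b (b', k, l, C, C')"
      using l bb(3) by (auto simp: T_def intro!: image_eqI[of _ _ x])
    ultimately show ?thesis by blast
  qed
  ultimately show ?thesis
    using I by (intro exI[of _ "\<lambda>b. \<Union>i\<in>I b. T b i"] ballI conjI allI impI compact_UN UN_least)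
qed

lemma invariant_cutoff:
  assumes m: "m \<in> P" and C: "\<And>b. b \<in> A \<Longrightarrow> compact (C b)" "\<And>b. b \<in> A \<Longrightarrow> C b \<subseteq> reach a m b" and \<delta>: "0 < \<delta>"
  shows "\<exists>h :: 'q \<Rightarrow> 'x \<Rightarrow> real. (\<forall>b\<in>A. continuous_on UNIV (h b) \<and> compact (closure {x. h b x \<noteq> 0}) \<and>
      closure {x. h b x \<noteq> 0} \<subseteq> reach a m b) \<and>
    (\<forall>b x. 0 \<le> h b x \<and> h b x \<le> 1) \<and> (\<forall>b\<in>A. \<forall>x\<in>C b. h b x = 1) \<and>
    (\<forall>b\<in>A. \<forall>b'\<in>A. \<forall>x y. linked x b y b' \<longrightarrow> \<bar>h b x - h b' y\<bar> \<le> \<delta> \<and> (x \<in> C b \<longrightarrow> h b' y = 1))"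
proof -
  show ?thesis
  proof (rule slowly_varying_cutoff[of A "reach a m" C linked \<delta>])
    fix h :: "'q \<Rightarrow> 'x \<Rightarrow> real" and S
    assume h: "\<And>b. b \<in> A \<Longrightarrow> continuous_on UNIV (h b)" "\<And>b x. 0 \<le> h b x" "\<And>b x. h b x \<le> 1"
      "\<And>b. b \<in> A \<Longrightarrow> compact (S b)" "\<And>b. b \<in> A \<Longrightarrow> S b \<subseteq> reach a m b" 
      "\<And>b x. b \<in> A \<Longrightarrow> x \<notin> S b \<Longrightarrow> h b x = 0" "\<And>b x. b \<in> A \<Longrightarrow> x \<in> C b \<Longrightarrow> h b x = 1"
      "\<And>x b y b'. b \<in> A \<Longrightarrow> b' \<in> A \<Longrightarrow> x \<in> C b \<Longrightarrow> linked x b y b' \<Longrightarrow> h b' y = 1"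
      "\<And>x b y b'. b \<in> A \<Longrightarrow> b' \<in> A \<Longrightarrow> linked x b y b' \<Longrightarrow> \<bar>h b x - h b' y\<bar> \<le> \<delta>"
    have clos: "closure {x. h b x \<noteq> 0} \<subseteq> S b" if "b \<in> A" for b
      using h(6)[OF that] by (intro closure_minimal compact_imp_closed[OF h(4)[OF that]]) auto
    then have "compact (closure {x. h b x \<noteq> 0})" if "b \<in> A" for b
      using compact_Int_closed[OF h(4)[OF that], of "closure {x. h b x \<noteq> 0}"] that by (simp add: inf.absorb2)
    moreover have "closure {x. h b x \<noteq> 0} \<subseteq> reach a m b" if "b \<in> A" for b
      by (rule order_trans[OF clos[OF that] h(5)[OF that]])
    ultimately show ?thesis
      by (intro exI[of _ h] conjI ballI allI impI) (assumption | rule h(1-3,7-9))+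
  next
    show "open (reach a m b)" for b by (rule open_reach[OF m])
  next
    show "\<exists>S'. \<forall>b\<in>A. compact (S' b) \<and> S' b \<subseteq> reach a m b \<and> (\<forall>b'\<in>A. \<forall>x\<in>S b'. \<forall>y. linked x b' y b \<longrightarrow> y \<in> S' b)"
      if "\<And>b. b \<in> A \<Longrightarrow> compact (S b) \<and> S b \<subseteq> reach a m b" for S
      by (rule linked_compact[OF m that])
  qed (use locally_compact C linked_sym \<delta> in simp_all)
qed

lemma continuous_on_cell:
  assumes "\<And>m. m \<in> M \<Longrightarrow> continuous_on S (h m)"
  shows "continuous_on S (\<lambda>x. cell M (\<lambda>m. h m x) J)"
  unfolding cell_def
proof (rule continuous_on_prod)
  fix m assume "m \<in> M"
  then show "continuous_on S (\<lambda>x. if m \<in> J then h m x else 1 - h m x)"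
    using assms by (cases "m \<in> J") (auto intro!: continuous_intros)
qed

text \<open>Pieces of mass are indexed by \<open>J\<close> and pushed forward to the level \<open>d J\<close>.\<close>
lemma local_moves:
  assumes S: "\<And>b. b \<in> A \<Longrightarrow> compact (S b)" "\<And>b. b \<in> A \<Longrightarrow> S b \<subseteq> reach a 0 b" and \<epsilon>: "0 < \<epsilon>"
  shows "\<exists>(N :: 'q set set) (c :: 'q set \<Rightarrow> 'q \<Rightarrow> 'x \<Rightarrow> real) d. finite N \<and>
    (\<forall>b\<in>A. \<forall>J\<in>N. continuous_on UNIV (c J b) \<and> (\<forall>x. 0 \<le> c J b x)) \<and>
    (\<forall>b\<in>A. \<forall>x. (\<Sum>J\<in>N. c J b x) = 1) \<and>
    (\<forall>b\<in>A. \<forall>J\<in>N. \<forall>x\<in>S b \<inter> closure {x. c J b x \<noteq> 0}. (x, - b + d J) \<in> D) \<and>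
    (\<forall>b\<in>A. \<forall>b'\<in>A. \<forall>x y. linked x b y b' \<longrightarrow> (\<Sum>J\<in>N. \<bar>c J b x - c J b' y\<bar>) \<le> \<epsilon> \<and>
      (\<forall>J\<in>N. x \<in> S b \<longrightarrow> c J b x \<noteq> 0 \<longrightarrow> c J b' y \<noteq> 0 \<longrightarrow> act x (- b + d J) = act y (- b' + d J)))"
proof -
  \<comment> \<open>The pair \<open>(0, UNIV)\<close> provides an anchor at every point of
    \<open>S b\<close>; the pairs from \<open>K\<close> provide, at a linked point, an anchor beyond
    the move of the link.\<close>
  define I where "I = insert (0, UNIV) ((\<lambda>(m, n, C, C'). (m, C)) ` K)"
  have I: "finite I" "\<And>n C. (n, C) \<in> I \<Longrightarrow> closed C \<and> C \<subseteq> Udom D n"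
    using finite_K K zero_in_D by (auto simp: I_def Udom_def intro: compact_imp_closed) blast
  have "\<exists>M E. finite M \<and> M \<subseteq> P \<and> (\<forall>m\<in>M. \<forall>b\<in>A. compact (E m b) \<and> E m b \<subseteq> reach a m b) \<and>
    (\<forall>(n, C)\<in>I. \<forall>b\<in>A. \<forall>x\<in>S b \<inter> C. \<exists>m\<in>M. \<exists>u. x \<in> interior (E m b) \<and> b + u = a + m \<and> semigroup_le P n u \<and> (x, u) \<in> D)"
    by (rule cover_by_moves_family[OF finite_A I S])
  then obtain M E where M: "finite M" "M \<subseteq> P" 
    and E: "\<forall>m\<in>M. \<forall>b\<in>A. compact (E m b) \<and> E m b \<subseteq> reach a m b"
    and covI: "\<forall>(n, C)\<in>I. \<forall>b\<in>A. \<forall>x\<in>S b \<inter> C. \<exists>m\<in>M. \<exists>u. x \<in> interior (E m b) \<and> b + u = a + m \<and> semigroup_le P n u \<and> (x, u) \<in> D"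
    by (elim exE conjE)
  have cov: "\<exists>m\<in>M. \<exists>u. x \<in> interior (E m b) \<and> b + u = a + m \<and> semigroup_le P n u \<and> (x, u) \<in> D"
    if "(n, C) \<in> I" "b \<in> A" "x \<in> S b" "x \<in> C" for n C b x
    using covI that by blast
  obtain \<delta> :: real where \<delta>: "0 < \<delta>" "2 ^ card M * (card M * \<delta>) \<le> \<epsilon>"
    using cell_tolerance[OF \<epsilon>] by blast
  define Q where "Q m h \<longleftrightarrow> (\<forall>b\<in>A. continuous_on UNIV (h b) \<and> compact (closure {x. h b x \<noteq> 0}) \<and>
      closure {x. h b x \<noteq> 0} \<subseteq> reach a m b) \<and>
    (\<forall>b x. 0 \<le> h b x \<and> h b x \<le> 1) \<and> (\<forall>b\<in>A. \<forall>x\<in>E m b. h b x = 1) \<and>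
    (\<forall>b\<in>A. \<forall>b'\<in>A. \<forall>x y. linked x b y b' \<longrightarrow> \<bar>h b x - h b' y\<bar> \<le> \<delta> \<and> (x \<in> E m b \<longrightarrow> h b' y = 1))"
    for m and h :: "'q \<Rightarrow> 'x \<Rightarrow> real"
  have "\<exists>h. Q m h" if "m \<in> M" for m
    unfolding Q_def by (rule invariant_cutoff[OF _ _ _ \<delta>(1)]) (use that M(2) E in blast)+
  then obtain h where h: "\<And>m. m \<in> M \<Longrightarrow> Q m (h m)" by metis
  have cont: "continuous_on UNIV (h m b)" and supp: "closure {x. h m b x \<noteq> 0} \<subseteq> reach a m b"
    and one: "x \<in> E m b \<Longrightarrow> h m b x = 1" if "m \<in> M" "b \<in> A" for m b x
    using h[OF that(1)] that(2) unfolding Q_def by blast+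
  have unit: "0 \<le> h m b x \<and> h m b x \<le> 1" if "m \<in> M" for m b x
    using h[OF that(1)] unfolding Q_def by blast
  have var: "\<bar>h m b x - h m b' y\<bar> \<le> \<delta>" "x \<in> E m b \<Longrightarrow> h m b' y = 1" 
    if "m \<in> M" "b \<in> A" "b' \<in> A" "linked x b y b'" for m b b' x y
    using h[OF that(1)] that(2-4) unfolding Q_def by blast+
  define c where "c J b x = cell M (\<lambda>m. h m b x) J" for J b x
  \<comment> \<open>The target level depends on \<open>J\<close> only, not on the point or on its
    own level.\<close>
  define d where "d J = a + top_of J" for J
  have fin: "finite J" if "J \<in> Pow M" for J using that M(1) finite_subset by blast
  have nz: "h m b x \<noteq> 0" if "J \<in> Pow M" "c J b x \<noteq> 0" "m \<in> J" for J m b x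
    using cell_eq_0[OF M(1), of m J "\<lambda>m. h m b x"] that unfolding c_def by blast
  have mem: "m \<in> J" if "J \<in> Pow M" "c J b x \<noteq> 0" "m \<in> M" "h m b x = 1" for J m b x
    using cell_eq_0[OF M(1), of m J "\<lambda>m. h m b x"] that unfolding c_def by blast
  show ?thesis
  proof (intro exI[of _ "Pow M"] exI[of _ c] exI[of _ d] conjI ballI allI impI, goal_cases)
    case 1 show ?case using M(1) by simp
  next
    case 2 then show ?case unfolding c_def by (intro continuous_on_cell cont) auto
  next
    case 3 show ?case unfolding c_def by (rule cell_nonneg) (rule unit)
  next
    case 4 show ?case unfolding c_def by (rule cell_sum[OF M(1)])
  next
    case (5 b J x)
    have "(0, UNIV) \<in> I" by (simp add: I_def)
    from cov[OF this 5(1)] 5(3) obtain m u where m: "m \<in> M" "x \<in> interior (E m b)" "b + u = a + m" "(x, u) \<in> D" by blast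
    have mJ: "m \<in> J"
    proof -
      \<comment> \<open>\<open>x\<close> is only a limit of points of nonzero weight, so such a
        point is found inside \<open>interior (E m b)\<close>, where the cutoff for \<open>m\<close>
        equals 1; this forces the anchor index \<open>m\<close> into \<open>J\<close>.\<close>
      have "x \<in> closure (interior (E m b) \<inter> {x. c J b x \<noteq> 0})"
        using 5(3) m(2) open_Int_closure_subset[OF open_interior, of "E m b" "{x. c J b x \<noteq> 0}"] by blast
      then have "interior (E m b) \<inter> {x. c J b x \<noteq> 0} \<noteq> {}" by (metis closure_empty empty_iff)
      then obtain x' where "c J b x' \<noteq> 0" "x' \<in> E m b" using interior_subset by blast
      then show ?thesis using mem[OF 5(2)] one m(1) 5(1) by blast
    qed
    have reach: "x \<in> reach a k b" if "k \<in> J" for k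
    proof -
      have "{x. c J b x \<noteq> 0} \<subseteq> {x. h k b x \<noteq> 0}" using nz[OF 5(2) _ that] by blast
      then have "x \<in> closure {x. h k b x \<noteq> 0}" using 5(3) closure_mono by blast
      then show ?thesis using supp[of k b] that 5(1,2) by blast
    qed
    have "J \<subseteq> P" using 5(2) M(2) by blast
    note top = reach_top_of[OF fin[OF 5(2)] _ this reach]
    obtain p where "(x, u + p) \<in> D" "u + p = - b + (a + top_of J)"
      using reach_imp_move[OF top(2) top(1)[OF _ _ mJ] m(4,3)] mJ by blast
    then show ?case by (simp add: d_def)
  next
    case (6 b b' x y)
    have "(\<Sum>J\<in>Pow M. \<bar>c J b x - c J b' y\<bar>) \<le> 2 ^ card M * (card M * \<delta>)"
      unfolding c_def by (rule cell_diff[OF M(1) unit unit var(1)]) (use 6 in auto)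
    then show ?case using \<delta>(2) by simp
  next
    case (7 b b' x y J)
    obtain k l C C' where l: "(k, l, C, C') \<in> K" "x \<in> C" "y \<in> C'" "(x, k) \<in> D" "(y, l) \<in> D" "act x k = act y l" "b + k = b' + l"
      using 7(3) by (rule linkedE)
    have "(k, C) \<in> I" unfolding I_def by (intro insertI2 image_eqI[OF _ l(1)]) simp
    from cov[OF this 7(1,5) l(2)]
    obtain m u where m: "m \<in> M" "x \<in> interior (E m b)" "b + u = a + m" "semigroup_le P k u" "(x, u) \<in> D" by (elim bexE exE conjE)
    have "x \<in> E m b" using m(2) interior_subset[of "E m b"] by (rule subsetD[rotated])
    then have mJ: "m \<in> J" by (intro mem[OF 7(4,6) m(1)] one[OF m(1) 7(1)])
    have reach: "x \<in> reach a j b" if "j \<in> J" for j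
    proof -
      have "x \<in> {x. h j b x \<noteq> 0}" using nz[OF 7(4,6) that] by simp
      then have "x \<in> closure {x. h j b x \<noteq> 0}" by (rule subsetD[OF closure_subset])
      moreover have "j \<in> M" using that 7(4) by blast
      ultimately show ?thesis using supp 7(1) by blast
    qed
    have "J \<subseteq> P" using 7(4) M(2) by blast
    note top = reach_top_of[OF fin[OF 7(4)] _ this reach]
    obtain p where p: "p \<in> P" "(x, u + p) \<in> D" "u + p = - b + (a + top_of J)"
      using reach_imp_move[OF top(2) top(1)[OF _ _ mJ] m(5,3)] mJ by blast
    obtain t where t: "t \<in> P" "u = k + t" using m(4) by (auto simp: semigroup_le_def)
    \<comment> \<open>The move of \<open>x\<close> to level \<open>d J\<close> starts with the
      linking move \<open>k\<close>. Replacing \<open>k\<close> by \<open>l\<close> gives a move of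
      \<open>y\<close> to the same level and the same point.\<close>
    have kt: "k + (t + p) = - b + (a + top_of J)" using p(3) t(2) by (simp add: add.assoc)
    have "l + (t + p) = - b' + (b' + l + (t + p))" by (simp add: add.assoc)
    also have "b' + l + (t + p) = b + (k + (t + p))" using l(7) by (metis add.assoc)
    also have "\<dots> = a + top_of J" using kt by simp
    finally have lt: "l + (t + p) = - b' + (a + top_of J)" .
    have "act y (l + (t + p)) = act x (k + (t + p))"
      by (rule move_along(2)[OF l(4-6)]) (use t p add_in_P in \<open>auto simp: add.assoc\<close>)
    then show ?case using kt lt by (simp add: d_def)
  qed
qed

end

section \<open>Combining the reference levels\<close>

context sdp_links begin

text \<open>\<open>local_moves\<close> works relative to one level \<open>a\<close> and only inside
  its saturation. The expansion over the cutoffs \<open>h a\<close> for \<open>a \<in> A\<close>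
  decides which levels are active, and a fixed choice among them decides whose moves are
  used.\<close>

lemma approx_invariant_moves:
  assumes \<epsilon>: "0 < \<epsilon>"
  shows "\<exists>(I :: ('q set \<times> 'q set) set) (\<kappa> :: 'q set \<times> 'q set \<Rightarrow> 'q \<Rightarrow> 'x \<Rightarrow> real) t. finite I \<and>
    (\<forall>b\<in>A. \<forall>i\<in>I. continuous_on UNIV (\<kappa> i b) \<and> (\<forall>x. 0 \<le> \<kappa> i b x)) \<and>
    (\<forall>b\<in>A. \<forall>x. (\<Sum>i\<in>I. \<kappa> i b x) = 1) \<and>
    (\<forall>b\<in>A. \<forall>i\<in>I. \<forall>x\<in>closure {x. \<kappa> i b x \<noteq> 0}. (x, t i b) \<in> D) \<and>
    (\<forall>b\<in>A. \<forall>b'\<in>A. \<forall>x y. linked x b y b' \<longrightarrow> (\<Sum>i\<in>I. \<bar>\<kappa> i b x - \<kappa> i b' y\<bar>) \<le> \<epsilon> \<and>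
      (\<forall>i\<in>I. \<kappa> i b x \<noteq> 0 \<longrightarrow> \<kappa> i b' y \<noteq> 0 \<longrightarrow> b + t i b = b' + t i b' \<and> act x (t i b) = act y (t i b')))"
proof -
  have \<epsilon>2: "0 < \<epsilon> / 2" using \<epsilon> by simp
  define T where "T = (\<Union>(m, n, C, C')\<in>K. C)"
  have T: "compact T" unfolding T_def using K by (intro compact_UN finite_K) auto
  obtain \<delta> :: real where \<delta>: "0 < \<delta>" "2 ^ card A * (card A * \<delta>) \<le> \<epsilon> / 2"
    using cell_tolerance[OF \<epsilon>2] by blast
  define Q where "Q a h \<longleftrightarrow> (\<forall>b\<in>A. continuous_on UNIV (h b) \<and> compact (closure {x. h b x \<noteq> 0}) \<and>
      closure {x. h b x \<noteq> 0} \<subseteq> reach a 0 b) \<and>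
    (\<forall>b x. 0 \<le> h b x \<and> h b x \<le> 1) \<and> (\<forall>b\<in>A. \<forall>x\<in>(if b = a then T else {}). h b x = 1) \<and>
    (\<forall>b\<in>A. \<forall>b'\<in>A. \<forall>x y. linked x b y b' \<longrightarrow> 
      \<bar>h b x - h b' y\<bar> \<le> \<delta> \<and> (x \<in> (if b = a then T else {}) \<longrightarrow> h b' y = 1))"
    for a and h :: "'q \<Rightarrow> 'x \<Rightarrow> real"
  \<comment> \<open>\<open>reach a 0 a\<close> is the whole space, so the cutoff for
    \<open>a\<close> may be required to equal 1 on \<open>T\<close> at level \<open>a\<close>;
    elsewhere nothing is prescribed.\<close>
  have "\<exists>h. Q a h" for a
    unfolding Q_def by (rule invariant_cutoff[OF zero_in_P _ _ \<delta>(1)]) (use T reach_self in auto)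
  then obtain h where h: "\<And>a. Q a (h a)" by metis
  have cont: "continuous_on UNIV (h a b)" and cpt: "compact (closure {x. h a b x \<noteq> 0})" 
    and supp: "closure {x. h a b x \<noteq> 0} \<subseteq> reach a 0 b" if "b \<in> A" for a b
    using h[of a] that unfolding Q_def by blast+
  have unit: "0 \<le> h a b x \<and> h a b x \<le> 1" for a b x
    using h[of a] unfolding Q_def by blast
  have one: "h b b x = 1" if "b \<in> A" "x \<in> T" for b x
    using h[of b] that unfolding Q_def by auto
  have var: "\<bar>h a b x - h a b' y\<bar> \<le> \<delta>" if "b \<in> A" "b' \<in> A" "linked x b y b'" for a b b' x y
    using h[of a] that unfolding Q_def by blast
  define R where "R a N c d \<longleftrightarrow> finite N \<and>
    (\<forall>b\<in>A. \<forall>J\<in>N. continuous_on UNIV (c J b) \<and> (\<forall>x. 0 \<le> c J b x)) \<and>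
    (\<forall>b\<in>A. \<forall>x. (\<Sum>J\<in>N. c J b x) = 1) \<and>
    (\<forall>b\<in>A. \<forall>J\<in>N. \<forall>x\<in>closure {x. h a b x \<noteq> 0} \<inter> closure {x. c J b x \<noteq> 0}. (x, - b + d J) \<in> D) \<and>
    (\<forall>b\<in>A. \<forall>b'\<in>A. \<forall>x y. linked x b y b' \<longrightarrow> (\<Sum>J\<in>N. \<bar>c J b x - c J b' y\<bar>) \<le> \<epsilon> / 2 \<and>
      (\<forall>J\<in>N. x \<in> closure {x. h a b x \<noteq> 0} \<longrightarrow> c J b x \<noteq> 0 \<longrightarrow> c J b' y \<noteq> 0 \<longrightarrow> 
        act x (- b + d J) = act y (- b' + d J)))"
    for a and N :: "'q set set" and c :: "'q set \<Rightarrow> 'q \<Rightarrow> 'x \<Rightarrow> real" and d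
  have "\<exists>N c d. R a N c d" for a
    unfolding R_def by (rule local_moves[OF cpt supp \<epsilon>2])
  then obtain N c d where R: "\<And>a. R a (N a) (c a) (d a)" by metis
  have N: "finite (N a)" for a using R unfolding R_def by blast
  have c_cont: "continuous_on UNIV (c a J b)" and c_pos: "0 \<le> c a J b x" 
    if "b \<in> A" "J \<in> N a" for a J b x
    using R[of a] that unfolding R_def by blast+
  have c_sum: "(\<Sum>J\<in>N a. c a J b x) = 1" if "b \<in> A" for a b x
    using R[of a] that unfolding R_def by blast
  have c_dom: "(x, - b + d a J) \<in> D" 
    if "b \<in> A" "J \<in> N a" "x \<in> closure {x. h a b x \<noteq> 0}" "x \<in> closure {x. c a J b x \<noteq> 0}" for a b J x
    using R[of a] that unfolding R_def by blast
  have c_var: "(\<Sum>J\<in>N a. \<bar>c a J b x - c a J b' y\<bar>) \<le> \<epsilon> / 2"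
    and c_eq: "J \<in> N a \<Longrightarrow> x \<in> closure {x. h a b x \<noteq> 0} \<Longrightarrow> c a J b x \<noteq> 0 \<Longrightarrow> c a J b' y \<noteq> 0 \<Longrightarrow>
        act x (- b + d a J) = act y (- b' + d a J)"
    if "b \<in> A" "b' \<in> A" "linked x b y b'" for a b b' x y J
    using R[of a] that unfolding R_def by blast+

  define s where "s I = (SOME a. a \<in> I)" for I :: "'q set"
  have s: "s I \<in> I" if "I \<noteq> {}" for I using that unfolding s_def by (rule some_in_eq[THEN iffD2])
  \<comment> \<open>With no active level there is a single dummy index \<open>{}\<close> of weight
    1, and the move is 0. At points of \<open>T\<close> this case carries no weight, since
    \<open>h b b x = 1\<close> puts \<open>b\<close> into the active set.\<close>
  define N' where "N' I = (if I = {} then {{}} else N (s I))" for I :: "'q set"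
  define c' where "c' I J b x = (if I = {} then 1 else c (s I) J b x)" for I J b x
  define w where "w I b x = cell A (\<lambda>a. h a b x) I" for I b x
  have N': "finite (N' I)" for I using N by (simp add: N'_def)
  have c'_pos: "0 \<le> c' I J b x" if "b \<in> A" "J \<in> N' I" for I J b x
    using that c_pos by (auto simp: c'_def N'_def split: if_splits)
  have c'_cont: "continuous_on UNIV (c' I J b)" if "b \<in> A" "J \<in> N' I" for I J b
    using that c_cont by (cases "I = {}") (auto simp: c'_def N'_def)
  have c'_sum: "(\<Sum>J\<in>N' I. c' I J b x) = 1" if "b \<in> A" for I b x
    using c_sum[OF that] by (simp add: c'_def N'_def)
  have c'_var: "(\<Sum>J\<in>N' I. \<bar>c' I J b x - c' I J b' y\<bar>) \<le> \<epsilon> / 2" 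
    if "b \<in> A" "b' \<in> A" "linked x b y b'" for I b b' x y
    using c_var[OF that] \<epsilon>2 by (simp add: c'_def N'_def)
  have w_pos: "0 \<le> w I b x" for I b x unfolding w_def by (rule cell_nonneg) (rule unit)
  have w_sum: "(\<Sum>I\<in>Pow A. w I b x) = 1" for b x unfolding w_def by (rule cell_sum[OF finite_A])
  have w_nz: "h a b x \<noteq> 0" if "I \<in> Pow A" "w I b x \<noteq> 0" "a \<in> I" for I a b x
    using cell_eq_0[OF finite_A, of a I "\<lambda>a. h a b x"] that unfolding w_def by blast
  have w_mem: "a \<in> I" if "w I b x \<noteq> 0" "a \<in> A" "h a b x = 1" for I a b x
    using cell_eq_0[OF finite_A, of a I "\<lambda>a. h a b x"] that unfolding w_def by blast
  define \<kappa> where "\<kappa> i b x = w (fst i) b x * c' (fst i) (snd i) b x" for i b x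
  define t where "t i b = (if fst i = {} then 0 else - b + d (s (fst i)) (snd i))" for i b
  let ?I = "SIGMA I:Pow A. N' I"
  have sumI: "(\<Sum>i\<in>?I. f i) = (\<Sum>I\<in>Pow A. \<Sum>J\<in>N' I. f (I, J))" for f :: "'q set \<times> 'q set \<Rightarrow> real"
    by (subst sum.Sigma) (use finite_A N' in auto)
  have both: "b + t i b = b' + t i b' \<and> act x (t i b) = act y (t i b')"
    if "b \<in> A" "b' \<in> A" "linked x b y b'" "i \<in> ?I" "\<kappa> i b x \<noteq> 0" "\<kappa> i b' y \<noteq> 0" for b b' x y i
  proof -
    have i: "fst i \<in> Pow A" using that(4) by auto
    have wx: "w (fst i) b x \<noteq> 0" using that(5) by (auto simp: \<kappa>_def)
    have "x \<in> T" using that(3) by (auto simp: T_def elim!: linkedE)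
    then have ne: "fst i \<noteq> {}" using w_mem[OF wx that(1)] one[OF that(1)] by blast
    have "x \<in> {x. h (s (fst i)) b x \<noteq> 0}" using w_nz[OF i wx s[OF ne]] by simp
    then have "x \<in> closure {x. h (s (fst i)) b x \<noteq> 0}" by (rule subsetD[OF closure_subset])
    from c_eq[OF that(1-3) _ this, of "snd i"] show ?thesis
      using that(4-6) ne by (auto simp: \<kappa>_def t_def c'_def N'_def add.assoc[symmetric] split: if_splits)
  qed
  show ?thesis
  proof (intro exI[of _ ?I] exI[of _ \<kappa>] exI[of _ t] conjI ballI allI impI, goal_cases)
    case 1 show ?case using finite_A N' by (intro finite_SigmaI) auto
  next
    case (2 b i)
    then show ?case unfolding \<kappa>_def w_def
      by (intro continuous_on_mult continuous_on_cell cont c'_cont) auto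
  next
    case (3 b i x)
    then show ?case unfolding \<kappa>_def by (intro mult_nonneg_nonneg w_pos c'_pos) auto
  next
    case (4 b x)
    have "(\<Sum>i\<in>?I. \<kappa> i b x) = (\<Sum>I\<in>Pow A. w I b x * (\<Sum>J\<in>N' I. c' I J b x))"
      unfolding sumI by (simp add: \<kappa>_def sum_distrib_left)
    then show ?case using c'_sum[OF 4] w_sum by simp
  next
    case (5 b i x)
    show ?case
    proof (cases "fst i = {}")
      case True
      then show ?thesis by (simp add: t_def zero_in_D)
    next
      case False
      have i: "fst i \<in> Pow A" "snd i \<in> N (s (fst i))" using 5(2) False by (auto simp: N'_def split: if_splits)
      have "{x. \<kappa> i b x \<noteq> 0} \<subseteq> {x. h (s (fst i)) b x \<noteq> 0}"
        using w_nz[OF i(1) _ s[OF False]] by (auto simp: \<kappa>_def)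
      then have x1: "x \<in> closure {x. h (s (fst i)) b x \<noteq> 0}" using 5(3) closure_mono by blast
      have "{x. \<kappa> i b x \<noteq> 0} \<subseteq> {x. c (s (fst i)) (snd i) b x \<noteq> 0}"
        using False by (auto simp: \<kappa>_def c'_def)
      then have x2: "x \<in> closure {x. c (s (fst i)) (snd i) b x \<noteq> 0}" using 5(3) closure_mono by blast
      show ?thesis using c_dom[OF 5(1) i(2) x1 x2] False by (simp add: t_def)
    qed
  next
    case (6 b b' x y)
    \<comment> \<open>A product rule: half of \<open>\<epsilon>\<close> pays for the variation of
      the outer weights \<open>w\<close>, the other half for that of the inner weights
      \<open>c'\<close>, whose errors are averaged by \<open>w\<close>.\<close>
    have "(\<Sum>i\<in>?I. \<bar>\<kappa> i b x - \<kappa> i b' y\<bar>) 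
        \<le> (\<Sum>I\<in>Pow A. \<Sum>J\<in>N' I. \<bar>w I b x - w I b' y\<bar> * c' I J b x + w I b' y * \<bar>c' I J b x - c' I J b' y\<bar>)"
      unfolding sumI
    proof (intro sum_mono)
      fix I J assume "J \<in> N' I"
      have "\<kappa> (I, J) b x - \<kappa> (I, J) b' y = (w I b x - w I b' y) * c' I J b x + w I b' y * (c' I J b x - c' I J b' y)"
        by (simp add: \<kappa>_def algebra_simps)
      also have "\<bar>\<dots>\<bar> \<le> \<bar>(w I b x - w I b' y) * c' I J b x\<bar> + \<bar>w I b' y * (c' I J b x - c' I J b' y)\<bar>"
        by (rule abs_triangle_ineq)
      finally show "\<bar>\<kappa> (I, J) b x - \<kappa> (I, J) b' y\<bar> 
          \<le> \<bar>w I b x - w I b' y\<bar> * c' I J b x + w I b' y * \<bar>c' I J b x - c' I J b' y\<bar>"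
        using c'_pos[OF 6(1) \<open>J \<in> N' I\<close>, of x] w_pos[of I b' y] by (simp add: abs_mult)
    qed
    also have "\<dots> = (\<Sum>I\<in>Pow A. \<bar>w I b x - w I b' y\<bar> * (\<Sum>J\<in>N' I. c' I J b x)) 
        + (\<Sum>I\<in>Pow A. w I b' y * (\<Sum>J\<in>N' I. \<bar>c' I J b x - c' I J b' y\<bar>))"
      by (simp add: sum.distrib sum_distrib_left)
    also have "\<dots> \<le> 2 ^ card A * (card A * \<delta>) + (\<Sum>I\<in>Pow A. w I b' y * (\<epsilon> / 2))"
    proof (intro add_mono sum_mono mult_left_mono)
      show "(\<Sum>I\<in>Pow A. \<bar>w I b x - w I b' y\<bar> * (\<Sum>J\<in>N' I. c' I J b x)) \<le> 2 ^ card A * (card A * \<delta>)"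
        unfolding c'_sum[OF 6(1)] w_def mult_1_right
        by (rule cell_diff[OF finite_A unit unit var[OF 6]])
    qed (use c'_var[OF 6] w_pos in auto)
    also have "\<dots> \<le> \<epsilon>" using \<delta>(2) w_sum[of b' y] unfolding sum_distrib_right[symmetric] by simp
    finally show ?case .
  next
    case (7 b b' x y i)
    then show ?case using both by blast
  next
    case (8 b b' x y i)
    then show ?case using both by blast
  qed
qed

end

section \<open>Systems of measures\<close>

lemma has_sum_atoms:
  fixes k :: "'j \<Rightarrow> real" and p :: "'j \<Rightarrow> 'h" and F :: "'h \<Rightarrow> real"
  assumes "finite J" and "\<And>j. j \<in> J \<Longrightarrow> k j \<noteq> 0 \<Longrightarrow> p j \<in> S"
  shows "((\<lambda>h. (\<Sum>j\<in>J. k j * of_bool (h = p j)) * F h) has_sum (\<Sum>j\<in>J. k j * F (p j))) S"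
  using assms
proof (induction J)
  case (insert j J)
  have "((\<lambda>h. k j * of_bool (h = p j) * F h) has_sum (k j * F (p j))) S"
  proof (cases "k j = 0")
    case False
    then have "p j \<in> S" using insert.prems by simp
    then have "((\<lambda>h. k j * of_bool (h = p j) * F h) has_sum (k j * F (p j))) S 
        \<longleftrightarrow> ((\<lambda>h. k j * F h) has_sum (k j * F (p j))) {p j}"
      by (intro has_sum_cong_neutral) auto
    moreover have "((\<lambda>h. k j * F h) has_sum (\<Sum>h\<in>{p j}. k j * F h)) {p j}" by (rule has_sum_finite) simp
    ultimately show ?thesis by simp
  qed simp
  moreover have "((\<lambda>h. (\<Sum>j\<in>J. k j * of_bool (h = p j)) * F h) has_sum (\<Sum>j\<in>J. k j * F (p j))) S"
    by (rule insert.IH) (use insert.prems in auto)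
  ultimately show ?case
    unfolding sum.insert[OF insert.hyps] distrib_right by (rule has_sum_add)
qed simp

text \<open>Matching atoms one by one bounds the distance of the two combinations; positions must
  agree only where both coefficients are nonzero, as otherwise one of the two atoms is
  absent.\<close>

lemma infsum_atoms_diff_le:
  fixes k k' :: "'j \<Rightarrow> real" and p p' :: "'j \<Rightarrow> 'h"
  assumes J: "finite J" and eq: "\<And>j. j \<in> J \<Longrightarrow> k j \<noteq> 0 \<Longrightarrow> k' j \<noteq> 0 \<Longrightarrow> p j = p' j"
  shows "(\<Sum>\<^sub>\<infinity>h\<in>S. \<bar>(\<Sum>j\<in>J. k j * of_bool (h = p j)) - (\<Sum>j\<in>J. k' j * of_bool (h = p' j))\<bar>) \<le> (\<Sum>j\<in>J. \<bar>k j - k' j\<bar>)"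
proof -
  let ?B = "p ` J \<union> p' ` J"
  let ?D = "\<lambda>h. \<bar>(\<Sum>j\<in>J. k j * of_bool (h = p j)) - (\<Sum>j\<in>J. k' j * of_bool (h = p' j))\<bar>"
  have B: "finite (S \<inter> ?B)" using J by simp
  have "?D h = 0" if "h \<notin> ?B" for h
  proof -
    have "(\<Sum>j\<in>J. k j * of_bool (h = p j)) = 0" "(\<Sum>j\<in>J. k' j * of_bool (h = p' j)) = 0"
      by (rule sum.neutral, use that in auto)+
    then show ?thesis by simp
  qed
  then have "(\<Sum>\<^sub>\<infinity>h\<in>S. ?D h) = (\<Sum>\<^sub>\<infinity>h\<in>S \<inter> ?B. ?D h)"
    by (intro infsum_cong_neutral) blast+
  also have "\<dots> = (\<Sum>h\<in>S \<inter> ?B. ?D h)" using B by simp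
  also have "\<dots> \<le> (\<Sum>h\<in>S \<inter> ?B. \<Sum>j\<in>J. \<bar>k j * of_bool (h = p j) - k' j * of_bool (h = p' j)\<bar>)"
    unfolding sum_subtractf[symmetric] by (intro sum_mono sum_abs)
  also have "\<dots> = (\<Sum>j\<in>J. \<Sum>h\<in>S \<inter> ?B. \<bar>k j * of_bool (h = p j) - k' j * of_bool (h = p' j)\<bar>)"
    by (rule sum.swap)
  also have "\<dots> \<le> (\<Sum>j\<in>J. \<bar>k j - k' j\<bar>)"
  proof (rule sum_mono)
    fix j assume j: "j \<in> J"
    \<comment> \<open>The position of the atom that is actually present.\<close>
    define r where "r = (if k j = 0 then p' j else p j)"
    have "(\<Sum>h\<in>S \<inter> ?B. \<bar>k j * of_bool (h = p j) - k' j * of_bool (h = p' j)\<bar>)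
        = (\<Sum>h\<in>S \<inter> ?B. if h = r then \<bar>k j - k' j\<bar> else 0)"
      using eq[OF j] by (intro sum.cong refl) (cases "k j = 0"; cases "k' j = 0"; auto simp: r_def)
    also have "\<dots> \<le> \<bar>k j - k' j\<bar>" using B by simp
    finally show "(\<Sum>h\<in>S \<inter> ?B. \<bar>k j * of_bool (h = p j) - k' j * of_bool (h = p' j)\<bar>) \<le> \<bar>k j - k' j\<bar>" .
  qed
  finally show ?thesis .
qed

text \<open>Lets a weight extend by zero a function defined along a move. Since the closure of the
  support lies in \<open>U\<close>, the open sets \<open>U\<close> and its complement cover the
  space.\<close>

lemma continuous_on_mult_supported:
  fixes k g :: "'a::topological_space \<Rightarrow> real"
  assumes "continuous_on UNIV k" "continuous_on U g" "open U" "closure {x. k x \<noteq> 0} \<subseteq> U"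
  shows "continuous_on UNIV (\<lambda>x. k x * g x)"
proof -
  have vanish: "0 = k x * g x" if "x \<in> - closure {x. k x \<noteq> 0}" for x
  proof -
    have "k x = 0" using that closure_subset[of "{x. k x \<noteq> 0}"] by auto
    then show ?thesis by (rule ssubst) simp
  qed
  have "continuous_on (- closure {x. k x \<noteq> 0}) (\<lambda>x. k x * g x)"
    by (rule continuous_on_eq[OF continuous_on_const vanish])
  moreover have "continuous_on U (\<lambda>x. k x * g x)"
    using assms(1,2) by (intro continuous_on_mult) (auto intro: continuous_on_subset)
  ultimately have "continuous_on (U \<union> - closure {x. k x \<noteq> 0}) (\<lambda>x. k x * g x)"
    using assms(3) by (intro continuous_on_open_Un) auto
  moreover have "U \<union> - closure {x. k x \<noteq> 0} = UNIV" using assms(4) by blast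
  ultimately show ?thesis by simp
qed

section \<open>Moves and compact sets in the groupoid topology\<close>

context sdp_action begin

lemma Udom_eq_empty: "t \<notin> P \<Longrightarrow> Udom D t = {}"
  using in_P by (auto simp: Udom_def)

text \<open>A basic set with \<open>m + - n = t\<close> has \<open>m = t + n\<close>, so
  \<open>act x m = act (act x t) n\<close> holds automatically and only open conditions on
  \<open>x\<close> remain.\<close>

lemma continuous_map_move:
  assumes t: "t \<in> P"
  shows "continuous_map (top_of_set (Udom D t)) (sdp_topology P D act) (\<lambda>x. (x, t, act x t))"
  unfolding sdp_topology_def continuous_on_generated_topo_iff
proof (intro conjI allI impI)
  let ?\<Z> = "{Zset D act U m n V |U m n V. open U \<and> open V \<and> m \<in> P \<and> n \<in> P}"
  fix Z assume "Z \<in> ?\<Z>"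
  then obtain U m n V where Z: "Z = Zset D act U m n V" "open U" "open V" "m \<in> P" "n \<in> P" by blast
  have "(\<lambda>x. (x, t, act x t)) -` Z \<inter> Udom D t = 
      (if m + - n = t then U \<inter> (Udom D t \<inter> (\<lambda>x. act x t) -` V) \<inter> Udom D m else {})"
  proof (cases "m + - n = t")
    case True
    then have m: "m = t + n" by (simp add: diff_eq_eq)
    show ?thesis
      using add_in_D_iff[OF t Z(5)] act_add[OF t Z(5)] True
      by (auto simp: Z(1) Zset_def Udom_def m)
  qed (auto simp: Z(1) Zset_def)
  moreover have "open (U \<inter> (Udom D t \<inter> (\<lambda>x. act x t) -` V) \<inter> Udom D m)"
    using Z by (intro open_Int continuous_open_preimage continuous_on_act open_Udom t)
  ultimately have "open ((\<lambda>x. (x, t, act x t)) -` Z \<inter> Udom D t)" by simp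
  then have "openin (top_of_set (Udom D t)) (Udom D t \<inter> ((\<lambda>x. (x, t, act x t)) -` Z \<inter> Udom D t))"
    by (rule openin_open_Int)
  then show "openin (top_of_set (Udom D t)) ((\<lambda>x. (x, t, act x t)) -` Z \<inter> topspace (top_of_set (Udom D t)))"
    by (simp add: Int_commute Int_left_absorb Int_assoc)
next
  have "(x, t, act x t) \<in> Zset D act UNIV t 0 UNIV" if "(x, t) \<in> D" for x
    using that zero_in_D act_zero by (auto simp: Zset_def)
  then show "(\<lambda>x. (x, t, act x t)) ` topspace (top_of_set (Udom D t))
    \<subseteq> \<Union> {Zset D act U m n V |U m n V. open U \<and> open V \<and> m \<in> P \<and> n \<in> P}"
    using t zero_in_P by (auto simp: Udom_def) blast
qed

lemma continuous_on_move:
  assumes "continuous_map (sdp_topology P D act) euclideanreal F"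
  shows "continuous_on (Udom D t) (\<lambda>x. F (x, t, act x t))"
proof (cases "t \<in> P")
  case True
  from continuous_map_compose[OF continuous_map_move[OF this] assms] show ?thesis by (simp add: o_def)
next
  case False
  then show ?thesis by (simp add: Udom_eq_empty)
qed

lemma move_in_fibre:
  assumes "(x, t) \<in> D"
  shows "(x, t, act x t) \<in> sdp_fibre (sdp_groupoid P D act) x"
proof -
  have "t = t + - 0 \<and> (x, t) \<in> D \<and> (act x t, 0) \<in> D \<and> act x t = act (act x t) 0"
    using assms zero_in_D act_zero by simp
  then have "\<exists>m\<in>P. \<exists>n\<in>P. t = m + - n \<and> (x, m) \<in> D \<and> (act x t, n) \<in> D \<and> act x m = act (act x t) n"
    using in_P[OF assms] zero_in_P by blast
  then show ?thesis by (simp add: sdp_fibre_def sdp_groupoid_def)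
qed

text \<open>Interiors of compact neighbourhoods give an open cover of \<open>S\<close>; a finite
  subcover is recorded by the compact sets themselves and then closed under inversion.\<close>

lemma compactin_cover:
  assumes "compactin (sdp_topology P D act) S"
  obtains K where "finite K"
    "\<And>m n C C'. (m, n, C, C') \<in> K \<Longrightarrow> m \<in> P \<and> n \<in> P \<and> compact C \<and> compact C' \<and> C \<subseteq> Udom D m \<and> C' \<subseteq> Udom D n"
    "\<And>m n C C'. (m, n, C, C') \<in> K \<Longrightarrow> (n, m, C', C) \<in> K"
    "\<And>x q y. (x, q, y) \<in> S \<Longrightarrow> \<exists>(m, n, C, C')\<in>K. q = m + - n \<and> x \<in> C \<and> y \<in> C' \<and> act x m = act y n"
proof -
  define I where "I = {(m, n, C, C'). m \<in> P \<and> n \<in> P \<and> compact C \<and> compact C' \<and> C \<subseteq> Udom D m \<and> C' \<subseteq> Udom D n}"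
  define Z where "Z = (\<lambda>(m, n, C, C'). Zset D act (interior C) m n (interior C'))"
  have "openin (sdp_topology P D act) (Z i)" if "i \<in> I" for i
    using that unfolding sdp_topology_def I_def Z_def
    by (intro topology_generated_by_Basis) (auto intro!: open_interior)
  moreover have "S \<subseteq> \<Union> (Z ` I)"
  proof
    fix g assume "g \<in> S"
    then have "g \<in> topspace (sdp_topology P D act)" using assms compactin_subset_topspace by blast
    then obtain m n x y where g: "g = (x, m + - n, y)" "m \<in> P" "n \<in> P" "(x, m) \<in> D" "(y, n) \<in> D" "act x m = act y n"
      unfolding sdp_topology_def by (auto simp: Zset_def)
    obtain C where C: "compact C" "x \<in> interior C" "C \<subseteq> Udom D m"
      using locally_compact_neighbourhood[OF locally_compact open_Udom[OF g(2)], of x] g(4) by (auto simp: Udom_def)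
    obtain C' where C': "compact C'" "y \<in> interior C'" "C' \<subseteq> Udom D n"
      using locally_compact_neighbourhood[OF locally_compact open_Udom[OF g(3)], of y] g(5) by (auto simp: Udom_def)
    have "(m, n, C, C') \<in> I" using g C C' by (simp add: I_def)
    moreover have "g \<in> Z (m, n, C, C')" using g C(2) C'(2) by (auto simp: Z_def Zset_def)
    ultimately show "g \<in> \<Union> (Z ` I)" by blast
  qed
  ultimately obtain \<F> where \<F>: "finite \<F>" "\<F> \<subseteq> Z ` I" "S \<subseteq> \<Union>\<F>"
    using compactinD[OF assms, of "Z ` I"] by blast
  then obtain K0 where K0: "K0 \<subseteq> I" "finite K0" "\<F> = Z ` K0" by (meson finite_subset_image)
  define K where "K = K0 \<union> (\<lambda>(m, n, C, C'). (n, m, C', C)) ` K0"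
  have KI: "(m, n, C, C') \<in> I" if "(m, n, C, C') \<in> K" for m n C C'
    using that K0(1) by (auto simp: K_def I_def)
  show thesis
  proof (rule that[of K])
    show "finite K" using K0(2) by (simp add: K_def)
    show "m \<in> P \<and> n \<in> P \<and> compact C \<and> compact C' \<and> C \<subseteq> Udom D m \<and> C' \<subseteq> Udom D n" if "(m, n, C, C') \<in> K" for m n C C'
      using KI[OF that] by (simp add: I_def)
    show "(n, m, C', C) \<in> K" if "(m, n, C, C') \<in> K" for m n C C'
      using that by (force simp: K_def)
    fix x q y assume "(x, q, y) \<in> S"
    then obtain i where i: "i \<in> K0" "(x, q, y) \<in> Z i" using \<F>(3) K0(3) by blast
    then show "\<exists>(m, n, C, C')\<in>K. q = m + - n \<and> x \<in> C \<and> y \<in> C' \<and> act x m = act y n"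
      unfolding K_def Z_def Zset_def by (intro bexI[of _ i]) (auto dest: subsetD[OF interior_subset])
  qed
qed

end

theorem theorem5p13:
  fixes P :: "('q::{group_add,countable}) set"
    and D :: "('x::{t2_space,second_countable_topology} \<times> 'q) set"
    and act :: "'x \<Rightarrow> 'q \<Rightarrow> 'x"
  assumes "amenable_group TYPE('q)"
    and "subsemigroup P"
    and "partial_action P D act"
    and "directed_action P D"
    and "locally_compact_action P D act"
  shows "sdp_topologically_amenable P D act"
proof -
  interpret sdp_action P D act by unfold_locales (fact assms)+
  let ?G = "sdp_groupoid P D act" and ?TG = "sdp_topology P D act"
  have "\<exists>\<mu>. continuous_prob_system ?TG ?G \<mu> \<and>
      (\<forall>g\<in>S. (\<Sum>\<^sub>\<infinity>h\<in>sdp_fibre ?G (fst g).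
               \<bar>\<mu> h - \<mu> (snd (snd g), - fst (snd g) + fst (snd h), snd (snd h))\<bar>) < \<epsilon>)"
    if S: "compactin ?TG S" and \<epsilon>: "0 < \<epsilon>" for S and \<epsilon> :: real
  proof -
    \<comment> \<open>One third bounds the variation of \<open>f\<close>, another that of the
      forward moves; their sum stays below \<open>\<epsilon>\<close>.\<close>
    have \<epsilon>3: "0 < \<epsilon> / 3" using \<epsilon> by simp
    obtain K where Kcov: "finite K"
      "\<And>m n C C'. (m, n, C, C') \<in> K \<Longrightarrow> m \<in> P \<and> n \<in> P \<and> compact C \<and> compact C' \<and> C \<subseteq> Udom D m \<and> C' \<subseteq> Udom D n"
      "\<And>m n C C'. (m, n, C, C') \<in> K \<Longrightarrow> (n, m, C', C) \<in> K"
      "\<And>x q y. (x, q, y) \<in> S \<Longrightarrow> \<exists>(m, n, C, C')\<in>K. q = m + - n \<and> x \<in> C \<and> y \<in> C' \<and> act x m = act y n"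
      by (rule compactin_cover[OF S]) (rule that, assumption+)
    let ?F = "(\<lambda>(m, n, C, C'). m + - n) ` K"
    obtain f :: "'q \<Rightarrow> real" and A where A: "finite A" and f: "\<And>b. 0 \<le> f b" "\<And>b. b \<notin> A \<Longrightarrow> f b = 0" "sum f A = 1"
      "\<And>g B. g \<in> ?F \<Longrightarrow> finite B \<Longrightarrow> (\<Sum>b\<in>B. \<bar>f b - f (b + g)\<bar>) < \<epsilon> / 3"
      by (rule reiter_right[OF assms(1) finite_imageI[OF Kcov(1)] \<epsilon>3]) blast
    interpret sdp_links P D act K A
      by unfold_locales (use Kcov A in blast)+
    obtain I :: "('q set \<times> 'q set) set" and \<kappa> :: "'q set \<times> 'q set \<Rightarrow> 'q \<Rightarrow> 'x \<Rightarrow> real" and t where I: "finite I"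
      and all: "\<forall>b\<in>A. \<forall>i\<in>I. continuous_on UNIV (\<kappa> i b) \<and> (\<forall>x. 0 \<le> \<kappa> i b x)"
        "\<forall>b\<in>A. \<forall>x. (\<Sum>i\<in>I. \<kappa> i b x) = 1"
        "\<forall>b\<in>A. \<forall>i\<in>I. \<forall>x\<in>closure {x. \<kappa> i b x \<noteq> 0}. (x, t i b) \<in> D"
        "\<forall>b\<in>A. \<forall>b'\<in>A. \<forall>x y. linked x b y b' \<longrightarrow> (\<Sum>i\<in>I. \<bar>\<kappa> i b x - \<kappa> i b' y\<bar>) \<le> \<epsilon> / 3 \<and>
          (\<forall>i\<in>I. \<kappa> i b x \<noteq> 0 \<longrightarrow> \<kappa> i b' y \<noteq> 0 \<longrightarrow> b + t i b = b' + t i b' \<and> act x (t i b) = act y (t i b'))"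
      using approx_invariant_moves[OF \<epsilon>3] by (elim exE conjE)
    have cont: "continuous_on UNIV (\<kappa> i b)" and pos: "0 \<le> \<kappa> i b x" 
      and dom: "closure {x. \<kappa> i b x \<noteq> 0} \<subseteq> Udom D (t i b)" if "b \<in> A" "i \<in> I" for i b x
      using all(1,3) that by (auto simp: Udom_def)
    have sum1: "(\<Sum>i\<in>I. \<kappa> i b x) = 1" if "b \<in> A" for b x using all(2) that by blast
    have var: "(\<Sum>i\<in>I. \<bar>\<kappa> i b x - \<kappa> i b' y\<bar>) \<le> \<epsilon> / 3"
      and eq: "i \<in> I \<Longrightarrow> \<kappa> i b x \<noteq> 0 \<Longrightarrow> \<kappa> i b' y \<noteq> 0 \<Longrightarrow> b + t i b = b' + t i b' \<and> act x (t i b) = act y (t i b')"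
      if "b \<in> A" "b' \<in> A" "linked x b y b'" for b b' x y i
      using all(4) that by blast+
    have dom': "(x, t i b) \<in> D" if "b \<in> A" "i \<in> I" "\<kappa> i b x \<noteq> 0" for b i x
    proof -
      have "x \<in> {x. \<kappa> i b x \<noteq> 0}" using that(3) by simp
      then have "x \<in> closure {x. \<kappa> i b x \<noteq> 0}" by (rule subsetD[OF closure_subset])
      then have "x \<in> Udom D (t i b)" by (rule subsetD[OF dom[OF that(1,2)]])
      then show ?thesis by (simp add: Udom_def)
    qed
    define k where "k j x = f (fst j) * \<kappa> (snd j) (fst j) x" for j x
    define p where "p j x = (x, t (snd j) (fst j), act x (t (snd j) (fst j)))" for j x
    \<comment> \<open>The measure at \<open>x\<close> has an atom at the \<open>i\<close>-th move of
      \<open>x\<close> at level \<open>b\<close>, with mass \<open>f b\<close> times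
      \<open>\<kappa> i b x\<close>.\<close>
    define \<mu> where "\<mu> h = (\<Sum>j\<in>A \<times> I. k j (fst h) * of_bool (h = p j (fst h)))" for h :: "'x \<times> 'q \<times> 'x"
    have fin: "finite (A \<times> I)" using A I by simp
    have pfib: "p j x \<in> sdp_fibre ?G x" if "j \<in> A \<times> I" "k j x \<noteq> 0" for j x
    proof -
      have "(x, t (snd j) (fst j)) \<in> D" using that by (intro dom') (auto simp: k_def)
      then show ?thesis unfolding p_def by (rule move_in_fibre)
    qed
    have has_sum: "((\<lambda>h. \<mu> h * F h) has_sum (\<Sum>j\<in>A \<times> I. k j x * F (p j x))) (sdp_fibre ?G x)" for x F
    proof -
      have "((\<lambda>h. (\<Sum>j\<in>A \<times> I. k j x * of_bool (h = p j x)) * F h) has_sum (\<Sum>j\<in>A \<times> I. k j x * F (p j x))) (sdp_fibre ?G x)"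
        by (rule has_sum_atoms[OF fin pfib])
      then show ?thesis
        by (rule has_sum_cong[THEN iffD1, rotated]) (auto simp: \<mu>_def sdp_fibre_def)
    qed
    have mass: "(\<Sum>j\<in>A \<times> I. k j x) = 1" for x
    proof -
      have "(\<Sum>j\<in>A \<times> I. k j x) = (\<Sum>b\<in>A. f b * (\<Sum>i\<in>I. \<kappa> i b x))"
        by (simp add: k_def sum.cartesian_product' sum_distrib_left)
      then show ?thesis using sum1 f(3) by simp
    qed
    have "continuous_prob_system ?TG ?G \<mu>"
      unfolding continuous_prob_system_def
    proof (intro conjI ballI allI impI)
      show "0 \<le> \<mu> h" for h
        unfolding \<mu>_def k_def by (intro sum_nonneg mult_nonneg_nonneg f(1) pos) auto
      show "(\<mu> has_sum 1) (sdp_fibre ?G x)" for x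
        using has_sum[where F = "\<lambda>_. 1"] mass by simp
      fix F :: "'x \<times> 'q \<times> 'x \<Rightarrow> real" 
      assume F: "continuous_map ?TG euclideanreal F \<and> compactin ?TG (?TG closure_of {h \<in> topspace ?TG. F h \<noteq> 0})"
      have "(\<Sum>\<^sub>\<infinity>h\<in>sdp_fibre ?G x. \<mu> h * F h) = (\<Sum>j\<in>A \<times> I. k j x * F (p j x))" for x
        by (rule infsumI[OF has_sum])
      moreover have "continuous_on UNIV (\<lambda>x. k j x * F (p j x))" if j: "j \<in> A \<times> I" for j
      proof -
        have "continuous_on UNIV (\<lambda>x. \<kappa> (snd j) (fst j) x * F (p j x))"
          unfolding p_def
        proof (rule continuous_on_mult_supported)
          have jAI: "fst j \<in> A" "snd j \<in> I" using j by auto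
          show "continuous_on UNIV (\<kappa> (snd j) (fst j))" by (rule cont[OF jAI])
          show "closure {x. \<kappa> (snd j) (fst j) x \<noteq> 0} \<subseteq> Udom D (t (snd j) (fst j))" by (rule dom[OF jAI])
          show "continuous_on (Udom D (t (snd j) (fst j))) (\<lambda>x. F (x, t (snd j) (fst j), act x (t (snd j) (fst j))))"
            by (rule continuous_on_move[OF conjunct1[OF F]])
          show "open (Udom D (t (snd j) (fst j)))"
            by (cases "t (snd j) (fst j) \<in> P") (simp_all add: open_Udom Udom_eq_empty)
        qed
        then show ?thesis unfolding k_def mult.assoc by (rule continuous_on_mult_left)
      qed
      ultimately show "continuous_on UNIV (\<lambda>x. \<Sum>\<^sub>\<infinity>h\<in>sdp_fibre ?G x. \<mu> h * F h)"
        by (simp only:) (rule continuous_on_sum)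
    qed
    moreover have "(\<Sum>\<^sub>\<infinity>h\<in>sdp_fibre ?G (fst g).
               \<bar>\<mu> h - \<mu> (snd (snd g), - fst (snd g) + fst (snd h), snd (snd h))\<bar>) < \<epsilon>" if g: "g \<in> S" for g
    proof -
      obtain x q y where gq: "g = (x, q, y)" by (metis prod_cases3)
      obtain m n C C' where mn: "(m, n, C, C') \<in> K" "q = m + - n" "x \<in> C" "y \<in> C'" "act x m = act y n"
        using Kcov(4)[OF g[unfolded gq]] by (auto simp del: add_uminus_conv_diff)
      have qF: "q \<in> ?F" by (intro image_eqI[OF _ mn(1)]) (simp add: mn(2))
      have qn: "q + n = m" using mn(2) by simp
      \<comment> \<open>Comparing level \<open>b\<close> at \<open>x\<close> with level
        \<open>b + q\<close> at \<open>y\<close> cancels the cocycle value of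
        \<open>g\<close>.\<close>
      have link: "linked x b y (b + q)" for b
        unfolding linked_def by (rule bexI[OF _ mn(1)]) (simp add: mn(3-5) add.assoc qn)
      \<comment> \<open>Large enough that both \<open>B\<close> and its right translate by
        \<open>q\<close> contain \<open>A\<close>; the extra terms vanish with
        \<open>f\<close>.\<close>
      define B where "B = A \<union> (\<lambda>b. b + - q) ` A"
      have B: "finite B" using A by (simp add: B_def)
      let ?k' = "\<lambda>j. k (fst j + q, snd j) y" 
      let ?p' = "\<lambda>j. (x, q + t (snd j) (fst j + q), act y (t (snd j) (fst j + q)))"
      have k0: "k j z = 0" if "fst j \<notin> A" for j z using that f(2) by (simp add: k_def)
      have extend: "(\<Sum>j\<in>A \<times> I. k j z * F j) = (\<Sum>j\<in>L. k j z * F j)"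
        if "A \<times> I \<subseteq> L" "L \<subseteq> UNIV \<times> I" "finite L" for L z and F :: "'q \<times> 'q set \<times> 'q set \<Rightarrow> real"
      proof (rule sum.mono_neutral_left[OF that(3,1)], rule ballI)
        fix j assume j: "j \<in> L - A \<times> I"
        then have "j \<in> UNIV \<times> I" by (intro subsetD[OF that(2)]) simp
        then have "fst j \<notin> A" using j by (simp add: mem_Times_iff)
        then show "k j z * F j = 0" using k0 by simp
      qed
      have \<mu>1: "\<mu> h = (\<Sum>j\<in>B \<times> I. k j x * of_bool (h = p j x))" if "fst h = x" for h
        unfolding \<mu>_def that by (rule extend) (use B I in \<open>auto simp: B_def\<close>)
      have \<mu>2: "\<mu> (y, - q + fst (snd h), snd (snd h)) = (\<Sum>j\<in>B \<times> I. ?k' j * of_bool (h = ?p' j))" if "fst h = x" for h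
      proof -
        have inj: "inj_on (\<lambda>j. (fst j + q, snd j)) (B \<times> I)" by (auto simp: inj_on_def)
        have sub: "A \<times> I \<subseteq> (\<lambda>j. (fst j + q, snd j)) ` (B \<times> I)"
        proof
          fix j assume "j \<in> A \<times> I"
          then show "j \<in> (\<lambda>j. (fst j + q, snd j)) ` (B \<times> I)"
            by (intro image_eqI[of _ _ "(fst j + - q, snd j)"]) (auto simp: B_def add.assoc)
        qed
        have "\<mu> (y, - q + fst (snd h), snd (snd h)) 
            = (\<Sum>j\<in>A \<times> I. k j y * of_bool ((y, - q + fst (snd h), snd (snd h)) = p j y))"
          by (simp add: \<mu>_def)
        also have "\<dots> = (\<Sum>j\<in>(\<lambda>j. (fst j + q, snd j)) ` (B \<times> I). k j y * of_bool ((y, - q + fst (snd h), snd (snd h)) = p j y))"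
          by (rule extend[OF sub]) (use B I in auto)
        also have "\<dots> = (\<Sum>j\<in>B \<times> I. ?k' j * of_bool ((y, - q + fst (snd h), snd (snd h)) = p (fst j + q, snd j) y))"
          by (simp add: sum.reindex[OF inj])
        also have "\<dots> = (\<Sum>j\<in>B \<times> I. ?k' j * of_bool (h = ?p' j))"
        proof (rule sum.cong[OF refl])
          fix j assume "j \<in> B \<times> I"
          have "- q + r = s \<longleftrightarrow> r = q + s" for r s :: 'q by (metis add.assoc add.left_inverse add.right_inverse add_0)
          then show "?k' j * of_bool ((y, - q + fst (snd h), snd (snd h)) = p (fst j + q, snd j) y) 
              = ?k' j * of_bool (h = ?p' j)"
            using that by (cases h) (auto simp: p_def)
        qed
        finally show ?thesis .
      qed
      have "(\<Sum>\<^sub>\<infinity>h\<in>sdp_fibre ?G x. \<bar>\<mu> h - \<mu> (y, - q + fst (snd h), snd (snd h))\<bar>)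
          = (\<Sum>\<^sub>\<infinity>h\<in>sdp_fibre ?G x. \<bar>(\<Sum>j\<in>B \<times> I. k j x * of_bool (h = p j x)) - (\<Sum>j\<in>B \<times> I. ?k' j * of_bool (h = ?p' j))\<bar>)"
        by (rule infsum_cong) (use \<mu>1 \<mu>2 in \<open>auto simp: sdp_fibre_def\<close>)
      also have "\<dots> \<le> (\<Sum>j\<in>B \<times> I. \<bar>k j x - ?k' j\<bar>)"
      proof (rule infsum_atoms_diff_le)
        show "finite (B \<times> I)" using B I by simp
        fix j assume j: "j \<in> B \<times> I" "k j x \<noteq> 0" "?k' j \<noteq> 0"
        \<comment> \<open>For linked points, \<open>b + t i b = b + q + t i (b + q)\<close> cancels
          to \<open>t i b = q + t i (b + q)\<close>, so the translated atom coincides with the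
          original.\<close>
        have "fst j \<in> A" "fst j + q \<in> A" "\<kappa> (snd j) (fst j) x \<noteq> 0" "\<kappa> (snd j) (fst j + q) y \<noteq> 0"
          using j(2,3) f(2) by (auto simp: k_def)
        from eq[OF this(1,2) link _ this(3,4)] j(1) show "p j x = ?p' j"
          by (auto simp: p_def add.assoc)
      qed
      also have "\<dots> = (\<Sum>b\<in>B. \<Sum>i\<in>I. \<bar>f b * \<kappa> i b x - f (b + q) * \<kappa> i (b + q) y\<bar>)"
        by (simp add: k_def sum.cartesian_product')
      also have "\<dots> \<le> (\<Sum>b\<in>B. \<bar>f b - f (b + q)\<bar> + f (b + q) * (\<epsilon> / 3))"
      proof (rule sum_mono)
        fix b
        \<comment> \<open>The moves are controlled only at levels in \<open>A\<close>; where just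
          one of the two levels lies in \<open>A\<close>, the variation of \<open>f\<close> alone
          absorbs the whole term.\<close>
        consider "b \<in> A" "b + q \<in> A" | "b \<in> A" "b + q \<notin> A" | "b \<notin> A" "b + q \<in> A" | "b \<notin> A" "b + q \<notin> A" by blast
        then show "(\<Sum>i\<in>I. \<bar>f b * \<kappa> i b x - f (b + q) * \<kappa> i (b + q) y\<bar>) \<le> \<bar>f b - f (b + q)\<bar> + f (b + q) * (\<epsilon> / 3)"
        proof cases
          case 1
          have "(\<Sum>i\<in>I. \<bar>f b * \<kappa> i b x - f (b + q) * \<kappa> i (b + q) y\<bar>) 
              \<le> (\<Sum>i\<in>I. \<bar>f b - f (b + q)\<bar> * \<kappa> i b x + f (b + q) * \<bar>\<kappa> i b x - \<kappa> i (b + q) y\<bar>)"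
          proof (rule sum_mono)
            fix i assume "i \<in> I"
            have "f b * \<kappa> i b x - f (b + q) * \<kappa> i (b + q) y 
                = (f b - f (b + q)) * \<kappa> i b x + f (b + q) * (\<kappa> i b x - \<kappa> i (b + q) y)"
              by (simp add: algebra_simps)
            also have "\<bar>\<dots>\<bar> \<le> \<bar>(f b - f (b + q)) * \<kappa> i b x\<bar> + \<bar>f (b + q) * (\<kappa> i b x - \<kappa> i (b + q) y)\<bar>"
              by (rule abs_triangle_ineq)
            finally show "\<bar>f b * \<kappa> i b x - f (b + q) * \<kappa> i (b + q) y\<bar> 
                \<le> \<bar>f b - f (b + q)\<bar> * \<kappa> i b x + f (b + q) * \<bar>\<kappa> i b x - \<kappa> i (b + q) y\<bar>"
              using pos[OF 1(1) \<open>i \<in> I\<close>, of x] f(1)[of "b + q"] by (simp add: abs_mult)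
          qed
          also have "\<dots> = \<bar>f b - f (b + q)\<bar> * (\<Sum>i\<in>I. \<kappa> i b x) + f (b + q) * (\<Sum>i\<in>I. \<bar>\<kappa> i b x - \<kappa> i (b + q) y\<bar>)"
            by (simp add: sum.distrib sum_distrib_left)
          also have "\<dots> \<le> \<bar>f b - f (b + q)\<bar> * 1 + f (b + q) * (\<epsilon> / 3)"
            using sum1[OF 1(1)] var[OF 1 link] f(1) by (intro add_mono mult_left_mono) auto
          finally show ?thesis by simp
        next
          case 2
          have "(\<Sum>i\<in>I. \<bar>f b * \<kappa> i b x\<bar>) = f b * (\<Sum>i\<in>I. \<kappa> i b x)"
            unfolding sum_distrib_left using f(1) pos 2 by (intro sum.cong) auto
          then show ?thesis using f(1)[of b] f(2)[OF 2(2)] sum1[OF 2(1)] by simp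
        next
          case 3
          have "(\<Sum>i\<in>I. \<bar>f (b + q) * \<kappa> i (b + q) y\<bar>) = f (b + q) * (\<Sum>i\<in>I. \<kappa> i (b + q) y)"
            unfolding sum_distrib_left using f(1) pos 3 by (intro sum.cong) auto
          then show ?thesis using f(1)[of "b + q"] f(2)[OF 3(1)] sum1[OF 3(2)] \<epsilon> by simp
        next
          case 4
          then show ?thesis using f(2) by simp
        qed
      qed
      also have "\<dots> = (\<Sum>b\<in>B. \<bar>f b - f (b + q)\<bar>) + (\<Sum>b\<in>B. f (b + q)) * (\<epsilon> / 3)"
        by (simp add: sum.distrib sum_distrib_right)
      also have "(\<Sum>b\<in>B. f (b + q)) = (\<Sum>b\<in>(\<lambda>b. b + q) ` B. f b)"
        by (subst sum.reindex) (auto simp: inj_on_def)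
      also have "\<dots> = sum f A"
      proof (rule sum.mono_neutral_right)
        show "A \<subseteq> (\<lambda>b. b + q) ` B"
        proof
          fix b assume "b \<in> A"
          then show "b \<in> (\<lambda>b. b + q) ` B" by (intro image_eqI[of _ _ "b + - q"]) (auto simp: B_def)
        qed
      qed (use B f(2) in auto)
      also have "(\<Sum>b\<in>B. \<bar>f b - f (b + q)\<bar>) + sum f A * (\<epsilon> / 3) < \<epsilon>"
        using f(3) f(4)[OF qF B] \<epsilon> by simp
      finally show ?thesis by (simp add: gq)
    qed
    ultimately show ?thesis by blast
  qed
  then show ?thesis unfolding sdp_topologically_amenable_def Let_def by blast
qed

end
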